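(* Let $D\subset\mathbb{C}^n$ be a bounded homogeneous domain with $0\in D$, let $\mu:D\to(0,\infty)$ be a weight, let $\psi\in H(D)$ and let $\varphi$ be a holomorphic self-map of $D$. Let $W_{\psi,\varphi}f=\psi\,(f\circ\varphi)$. Then: (a) $W_{\psi,\varphi}:\mathcal{B}(D)\to H^\infty_\mu(D)$ is bounded if and only if $\psi\in H^\infty_\mu(D)$ and $\upsilon_\mu(\psi,\varphi)=\sup_{z\in D}\mu(z)|\psi(z)|\,\omega(\varphi(z))$ is finite; moreover, if it is bounded, then $\|W_{\psi,\varphi}\|=\max\{\|\psi\|_{H^\infty_\mu},\upsilon_\mu(\psi,\varphi)\}$. (b) $W_{\psi,\varphi}:\mathcal{B}_{0*}(D)\to H^\infty_\mu(D)$ is bounded if and only if $\psi\in H^\infty_\mu(D)$ and $\upsilon_{0,\mu}(\psi,\varphi)=\sup_{z\in D}\mu(z)|\psi(z)|\,\omega_0(\varphi(z))$ is finite; moreover, if it is bounded, then $\|W_{\psi,\varphi}\|=\max\{\|\psi\|_{H^\infty_\mu},\upsilon_{0,\mu}(\psi,\varphi)\}$.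
   Context: $H(D)$ denotes the holomorphic functions $D\to\mathbb{C}$. A domain is homogeneous if its group of biholomorphic automorphisms acts transitively. A weight is a continuous strictly positive function $\mu:D\to(0,\infty)$; $H^\infty_\mu(D)=\{f\in H(D):\|f\|_{H^\infty_\mu}=\sup_{z\in D}\mu(z)|f(z)|<\infty\}$. For $f\in H(D)$ and $z\in D$, $Q_f(z)=\sup_{u\in\mathbb{C}^n\setminus\{0\}}\frac{|\nabla f(z)u|}{H_z(u,\bar u)^{1/2}}$, where $\nabla f(z)u=\sum_k \frac{\partial f}{\partial z_k}(z)u_k$ and $H_z$ is the Bergman metric of $D$ at $z$. The Bloch space is $\mathcal{B}(D)=\{f\in H(D):\beta_f=\sup_{z\in D}Q_f(z)<\infty\}$ with norm $\|f\|_{\mathcal{B}}=|f(0)|+\beta_f$. The $*$-little Bloch space is $\mathcal{B}_{0*}(D)=\{f\in\mathcal{B}(D):\lim_{z\to\partial^* D}Q_f(z)=0\}$ (with the Bloch norm), where $\partial^*D$ is the distinguished boundary of $D$. For $z\in D$: $\omega(z)=\sup\{|f(z)|: f\in\mathcal{B}(D), f(0)=0, \|f\|_{\mathcal{B}}\le 1\}$ and $\omega_0(z)=\sup\{|f(z)|: f\in\mathcal{B}_{0*}(D), f(0)=0, \|f\|_{\mathcal{B}}\le 1\}$. *)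

theory Defs
  imports "HOL-Analysis.Analysis"
begin

type_synonym 'n cvec = "complex ^ 'n"

definition holo :: "('n::finite cvec \<Rightarrow> complex) \<Rightarrow> 'n cvec set \<Rightarrow> bool" where
  "holo f D \<longleftrightarrow> (\<forall>z\<in>D. \<exists>L. (f has_derivative L) (at z) \<and> (\<forall>c u. L (c *s u) = c * L u))"

definition holo_map :: "('n::finite cvec \<Rightarrow> 'm::finite cvec) \<Rightarrow> 'n cvec set \<Rightarrow> bool" where
  "holo_map g D \<longleftrightarrow> (\<forall>i. holo (\<lambda>z. g z $ i) D)"

definition domain :: "'n::finite cvec set \<Rightarrow> bool" where
  "domain D \<longleftrightarrow> open D \<and> connected D \<and> D \<noteq> {}"

definition biholo_auto :: "('n::finite cvec \<Rightarrow> 'n cvec) \<Rightarrow> 'n cvec set \<Rightarrow> bool" where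
  "biholo_auto g D \<longleftrightarrow> holo_map g D \<and> bij_betw g D D \<and> holo_map (inv_into D g) D"

definition homogeneous_domain :: "'n::finite cvec set \<Rightarrow> bool" where
  "homogeneous_domain D \<longleftrightarrow> domain D \<and>
     (\<forall>z\<in>D. \<forall>w\<in>D. \<exists>g. biholo_auto g D \<and> g z = w)"

text \<open>Diagonal of the Bergman kernel, via the extremal characterisation
  K(z,z) = sup { |f(z)|^2 : f in A^2(D), ||f||_{L^2(D)} <= 1 }.\<close>
definition bergman_diag :: "'n::finite cvec set \<Rightarrow> 'n cvec \<Rightarrow> real" where
  "bergman_diag D z = Sup {(cmod (f z))^2 | f. holo f D \<and>
      (\<integral>\<^sup>+ w. indicator D w * ennreal ((cmod (f w))^2) \<partial>lborel) \<le> 1}"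

text \<open>Bergman metric H_z(u, conj u) = sum_{j,k} d^2 log K / dz_j d conj z_k u_j conj u_k,
  written as (1/4) times the Laplacian of t \<mapsto> log K(z + t u) over the complex line.\<close>
definition bergman_metric :: "'n::finite cvec set \<Rightarrow> 'n cvec \<Rightarrow> 'n cvec \<Rightarrow> real" where
  "bergman_metric D z u =
     (deriv (deriv (\<lambda>t::real. ln (bergman_diag D (z + t *\<^sub>R u)))) 0
    + deriv (deriv (\<lambda>t::real. ln (bergman_diag D (z + t *\<^sub>R (\<i> *s u))))) 0) / 4"

definition grad_app :: "('n::finite cvec \<Rightarrow> complex) \<Rightarrow> 'n cvec \<Rightarrow> 'n cvec \<Rightarrow> complex" where
  "grad_app f z u = frechet_derivative f (at z) u"

definition Qf :: "'n::finite cvec set \<Rightarrow> ('n cvec \<Rightarrow> complex) \<Rightarrow> 'n cvec \<Rightarrow> real" where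
  "Qf D f z = Sup {cmod (grad_app f z u) / sqrt (bergman_metric D z u) | u. u \<noteq> 0}"

definition bloch_space :: "'n::finite cvec set \<Rightarrow> ('n cvec \<Rightarrow> complex) set" where
  "bloch_space D = {f. holo f D \<and> bdd_above (Qf D f ` D)}"

definition bloch_norm :: "'n::finite cvec set \<Rightarrow> ('n cvec \<Rightarrow> complex) \<Rightarrow> real" where
  "bloch_norm D f = cmod (f 0) + Sup (Qf D f ` D)"

definition max_boundary :: "'n::finite cvec set \<Rightarrow> 'n cvec set \<Rightarrow> bool" where
  "max_boundary D S \<longleftrightarrow> S \<subseteq> closure D \<and> closed S \<and>
     (\<forall>f. continuous_on (closure D) f \<and> holo f D \<longrightarrow>
        (\<forall>z\<in>closure D. \<exists>w\<in>S. cmod (f z) \<le> cmod (f w)))"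

definition dist_boundary :: "'n::finite cvec set \<Rightarrow> 'n cvec set" where
  "dist_boundary D = \<Inter> {S. max_boundary D S}"

definition little_bloch_star :: "'n::finite cvec set \<Rightarrow> ('n cvec \<Rightarrow> complex) set" where
  "little_bloch_star D = {f \<in> bloch_space D.
      \<forall>\<xi>\<in>dist_boundary D. ((Qf D f) \<longlongrightarrow> 0) (at \<xi> within D)}"

definition omega_fun :: "'n::finite cvec set \<Rightarrow> 'n cvec \<Rightarrow> real" where
  "omega_fun D z = Sup {cmod (f z) | f. f \<in> bloch_space D \<and> f 0 = 0 \<and> bloch_norm D f \<le> 1}"

definition omega0_fun :: "'n::finite cvec set \<Rightarrow> 'n cvec \<Rightarrow> real" where
  "omega0_fun D z = Sup {cmod (f z) | f. f \<in> little_bloch_star D \<and> f 0 = 0 \<and> bloch_norm D f \<le> 1}"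

definition weight :: "'n::finite cvec set \<Rightarrow> ('n cvec \<Rightarrow> real) \<Rightarrow> bool" where
  "weight D \<mu> \<longleftrightarrow> continuous_on D \<mu> \<and> (\<forall>z\<in>D. \<mu> z > 0)"

definition Hinf_space :: "'n::finite cvec set \<Rightarrow> ('n cvec \<Rightarrow> real) \<Rightarrow> ('n cvec \<Rightarrow> complex) set" where
  "Hinf_space D \<mu> = {f. holo f D \<and> bdd_above ((\<lambda>z. \<mu> z * cmod (f z)) ` D)}"

definition Hinf_norm :: "'n::finite cvec set \<Rightarrow> ('n cvec \<Rightarrow> real) \<Rightarrow> ('n cvec \<Rightarrow> complex) \<Rightarrow> real" where
  "Hinf_norm D \<mu> f = Sup ((\<lambda>z. \<mu> z * cmod (f z)) ` D)"

definition wcomp :: "('n::finite cvec \<Rightarrow> complex) \<Rightarrow> ('n cvec \<Rightarrow> 'n cvec) \<Rightarrow> ('n cvec \<Rightarrow> complex) \<Rightarrow> ('n cvec \<Rightarrow> complex)" where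
  "wcomp \<psi> \<phi> f = (\<lambda>z. \<psi> z * f (\<phi> z))"

definition bounded_op :: "('a \<Rightarrow> 'b) \<Rightarrow> 'a set \<Rightarrow> ('a \<Rightarrow> real) \<Rightarrow> 'b set \<Rightarrow> ('b \<Rightarrow> real) \<Rightarrow> bool" where
  "bounded_op T X nX Y nY \<longleftrightarrow> (\<forall>f\<in>X. T f \<in> Y) \<and> (\<exists>C. \<forall>f\<in>X. nY (T f) \<le> C * nX f)"

definition op_norm :: "('a \<Rightarrow> 'b) \<Rightarrow> 'a set \<Rightarrow> ('a \<Rightarrow> real) \<Rightarrow> ('b \<Rightarrow> real) \<Rightarrow> real" where
  "op_norm T X nX nY = Sup {nY (T f) | f. f \<in> X \<and> nX f \<le> 1}"

end

theory Submission
  imports Defs "HOL-Complex_Analysis.Cauchy_Integral_Formula"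
begin

text \<open>Constants have Bloch norm equal to their modulus, and \<open>|f(w) - f(0)| \<le> \<beta>\<^sub>f \<omega>(w)\<close>; hence
  \<open>\<mu>|\<psi>||f \<circ> \<phi>| \<le> \<mu>|\<psi>||f(0)| + \<beta>\<^sub>f \<mu>|\<psi>| \<omega>(\<phi>)\<close>, while the constant 1 and the functions
  in the definition of \<open>\<omega>\<close> show that this is sharp. The substance is that \<open>\<omega>\<close> and \<open>Q\<^sub>f\<close> are finite,
  so that none of the suprema is a junk value, i.e. that the Bergman metric is locally bounded
  above and positive definite. For this the kernel is written as the squared dual norm
  \<open>K(z,z) = \<parallel>ev\<^sub>z\<parallel>\<^sup>2\<close> of the evaluation functional on the Bergman space. The inner product
  of the dual is obtained from approximate Riesz representers, so completeness is not needed.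
  Differentiating \<open>ln \<parallel>ev\<^sub>z\<parallel>\<^sup>2\<close> gives \<open>H\<^sub>z(u) = \<parallel>P\<parallel>\<^sup>2 / K(z,z)\<close>, where \<open>P\<close> is the component of the
  functional \<open>f \<mapsto> \<nabla>f(z)u\<close> orthogonal to \<open>ev\<^sub>z\<close>. Cauchy's estimate bounds it from above, and the linear
  form \<open>w \<mapsto> \<langle>w - z, u\<rangle>\<close>, which vanishes at \<open>z\<close>, bounds it from below.\<close>

subsection \<open>Holomorphic functions of several variables\<close>

text \<open>Every \<open>Sup\<close>, \<open>deriv\<close>, \<open>ln\<close> and quotient in the
  definitions is total, so an estimate says nothing until its terms are known to have the intended
  values. In particular \<open>bergman_metric\<close> is built from iterated \<open>deriv\<close>
  terms, while \<open>bergman_diag\<close> is a mere supremum with no visible smoothness. Smoothness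
  comes from the curve of evaluations at z + s u: Cauchy estimates bound all its derivatives in the
  dual norm, so it is differentiable there with quadratic error, and a product rule for the inner
  product of the dual differentiates its squared norm. Evaluations are bounded because |f|^2
  satisfies a mean value inequality on balls: on circles it is Cauchy's formula for f^2, and
  averaging over a ball uses the invariance of Lebesgue measure under unimodular scalars.
  Boundedness of the domain puts constants and linear forms into the Bergman space; connectedness
  carries the growth bound from 0 to every point. Both halves of the theorem are instances of one
  criterion for a class of Bloch functions that contains the constants and a f + b along with
  f.\<close>

lemma norm_vector_scalar_mult: "norm (c *s (u :: 'n::finite cvec)) = cmod c * norm u"
  by (simp add: norm_vec_def norm_mult L2_set_right_distrib)

lemma bounded_linear_vector_scalar_mult_left: "bounded_linear (\<lambda>s. s *s (u :: 'n::finite cvec))"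
  by (rule bounded_linear_intro[where K="norm u"])
     (auto simp: vec_eq_iff algebra_simps norm_vector_scalar_mult)

lemma holo_has_derivative:
  assumes "holo f D" "z \<in> D"
  shows "(f has_derivative grad_app f z) (at z)"
  using assms unfolding holo_def grad_app_def[abs_def]
  by (metis differentiableI frechet_derivative_works)

lemma grad_app_vector_scalar_mult:
  assumes "holo f D" "z \<in> D"
  shows "grad_app f z (c *s u) = c * grad_app f z u"
  using assms holo_has_derivative[OF assms] unfolding holo_def
  by (metis has_derivative_unique)

lemma holoI:
  assumes "\<And>z. z \<in> D \<Longrightarrow> (f has_derivative L z) (at z)"
    and "\<And>z c u. z \<in> D \<Longrightarrow> L z (c *s u) = c * L z u"
  shows "holo f D"
  using assms unfolding holo_def by blast

lemma grad_app_eqI: "(f has_derivative L) (at z) \<Longrightarrow> grad_app f z u = L u"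
  unfolding grad_app_def using frechet_derivative_at by metis

lemma holo_imp_continuous_on: "holo f D \<Longrightarrow> continuous_on D f"
  by (meson holo_has_derivative continuous_at_imp_continuous_on has_derivative_continuous)

lemma holo_lincomb:
  assumes "holo f D" "holo g D"
  shows "holo (\<lambda>z. a * f z + b * g z) D"
proof (rule holoI)
  fix z assume z: "z \<in> D"
  show "((\<lambda>z. a * f z + b * g z) has_derivative (\<lambda>u. a * grad_app f z u + b * grad_app g z u)) (at z)"
    by (intro derivative_intros holo_has_derivative[OF assms(1) z] holo_has_derivative[OF assms(2) z])
qed (simp add: grad_app_vector_scalar_mult[OF assms(1)] grad_app_vector_scalar_mult[OF assms(2)] algebra_simps)

lemma grad_app_lincomb:
  assumes "holo f D" "holo g D" "z \<in> D"
  shows "grad_app (\<lambda>z. a * f z + b * g z) z u = a * grad_app f z u + b * grad_app g z u"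
  by (rule grad_app_eqI)
     (intro derivative_intros holo_has_derivative[OF assms(1,3)] holo_has_derivative[OF assms(2,3)])

lemma holo_const: "holo (\<lambda>_. c) D"
  by (rule holoI[where L="\<lambda>_ _. 0"]) auto

lemma grad_app_const: "grad_app (\<lambda>_. c) z u = 0"
  by (rule grad_app_eqI) auto

lemma holo_mult:
  assumes "holo f D" "holo g D"
  shows "holo (\<lambda>z. f z * g z) D"
proof (rule holoI)
  fix z assume z: "z \<in> D"
  show "((\<lambda>z. f z * g z) has_derivative (\<lambda>u. f z * grad_app g z u + grad_app f z u * g z)) (at z)"
    by (intro derivative_intros holo_has_derivative[OF assms(1) z] holo_has_derivative[OF assms(2) z])
qed (simp add: grad_app_vector_scalar_mult[OF assms(1)] grad_app_vector_scalar_mult[OF assms(2)] algebra_simps)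

lemma holo_compose:
  fixes g :: "'n::finite cvec \<Rightarrow> 'm::finite cvec"
  assumes f: "holo f E" and g: "holo_map g D" and "g ` D \<subseteq> E"
  shows "holo (\<lambda>z. f (g z)) D"
proof (rule holoI)
  let ?G = "\<lambda>z u. \<chi> i. grad_app (\<lambda>z. g z $ i) z u"
  fix z assume z: "z \<in> D"
  have hg: "holo (\<lambda>z. g z $ i) D" for i :: 'm
    using g by (simp add: holo_map_def)
  have "(g has_derivative ?G z) (at z)"
  proof (subst has_derivative_componentwise_within, safe)
    fix b :: "'m cvec" assume "b \<in> Basis"
    then obtain i c where b: "b = axis i c"
      by (auto simp: Basis_vec_def)
    have "((\<lambda>x. g x $ i \<bullet> c) has_derivative (\<lambda>u. grad_app (\<lambda>z. g z $ i) z u \<bullet> c)) (at z)"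
      by (intro derivative_intros holo_has_derivative[OF hg z])
    then show "((\<lambda>x. g x \<bullet> b) has_derivative (\<lambda>u. ?G z u \<bullet> b)) (at z)"
      by (simp add: b inner_axis)
  qed
  moreover have "g z \<in> E" using z assms by auto
  ultimately show "((\<lambda>z. f (g z)) has_derivative (\<lambda>u. grad_app f (g z) (?G z u))) (at z)"
    using has_derivative_compose[OF _ holo_has_derivative[OF f]] by blast
next
  fix z c u assume z: "z \<in> D"
  have hg: "holo (\<lambda>z. g z $ i) D" for i :: 'm
    using g by (simp add: holo_map_def)
  have "(\<chi> i. grad_app (\<lambda>z. g z $ i) z (c *s u)) = c *s (\<chi> i. grad_app (\<lambda>z. g z $ i) z u)"
    by (simp add: vec_eq_iff grad_app_vector_scalar_mult[OF hg z])
  then show "grad_app f (g z) (\<chi> i. grad_app (\<lambda>z. g z $ i) z (c *s u)) = c * grad_app f (g z) (\<chi> i. grad_app (\<lambda>z. g z $ i) z u)"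
    using assms z by (simp add: grad_app_vector_scalar_mult[OF f] image_subset_iff)
qed

lemma holo_line_has_field_derivative:
  assumes "holo f D" "z + s *s u \<in> D"
  shows "((\<lambda>s. f (z + s *s u)) has_field_derivative grad_app f (z + s *s u) u) (at s)"
proof -
  have "((\<lambda>s. z + s *s u) has_derivative (\<lambda>s. s *s u)) (at s)"
    by (auto intro!: derivative_eq_intros bounded_linear_imp_has_derivative bounded_linear_vector_scalar_mult_left)
  from has_derivative_compose[OF this holo_has_derivative[OF assms]]
  show ?thesis
    by (simp add: has_field_derivative_def grad_app_vector_scalar_mult[OF assms] mult.commute[of _ "grad_app f (z + s *s u) u"])
qed

lemma holo_line_holomorphic:
  assumes "holo f D" "\<And>s. s \<in> S \<Longrightarrow> z + s *s u \<in> D"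
  shows "(\<lambda>s. f (z + s *s u)) holomorphic_on S"
  using holo_line_has_field_derivative[OF assms(1)] assms(2)
  by (meson field_differentiable_at_within field_differentiable_def holomorphic_onI)

subsection \<open>The dual of a pre-Hilbert space of functions\<close>

text \<open>The discriminant of a nonnegative quadratic, evaluated at its vertex; if
  \<open>a = 0\<close>, the point chosen below would give the value -1 unless \<open>b = 0\<close>.
  It serves both Cauchy-Schwarz and the estimate for near-minimisers.\<close>

lemma quadratic_nonneg_imp:
  fixes a b e :: real
  assumes "\<And>t. 0 \<le> e + 2 * b * t + a * t\<^sup>2" "0 \<le> a"
  shows "b\<^sup>2 \<le> a * e"
proof (cases "a = 0")
  case True
  have "b = 0"
  proof (rule ccontr)
    assume "b \<noteq> 0"
    then show False using assms(1)[of "-(e+1)/(2*b)"] True by simp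
  qed
  then show ?thesis using True by simp
next
  case False
  have "0 \<le> e + 2 * b * (-b/a) + a * (-b/a)\<^sup>2" by (rule assms)
  also have "\<dots> = e - b\<^sup>2 / a" using False by (simp add: power2_eq_square field_simps)
  finally show ?thesis using False assms(2) by (simp add: field_simps)
qed

text \<open>Rotating a test vector by \<open>c\<close> turns a real part into a full modulus, so
  that quadratics in a real variable suffice for complex inner products.\<close>

lemma ex_unimodular_mult_eq_cmod: "\<exists>c. cmod c = 1 \<and> c * w = of_real (cmod w)"
proof (cases "w = 0")
  case False
  have "cnj w * w = of_real (cmod w) * of_real (cmod w)"
    using complex_norm_square[of w] by (simp add: power2_eq_square mult.commute)
  then have "cmod (cnj w / cmod w) = 1" "cnj w / cmod w * w = of_real (cmod w)"
    using False by (auto simp: norm_divide field_simps)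
  then show ?thesis by blast
qed (auto intro: exI[of _ 1])

lemma tendsto_zero_of_bound:
  fixes X :: "nat \<Rightarrow> 'a::real_normed_vector"
  assumes "\<And>n. norm (X n) \<le> c * (1 / real (Suc n))"
  shows "X \<longlonglongrightarrow> 0"
proof (rule Lim_null_comparison)
  show "\<forall>\<^sub>F n in sequentially. norm (X n) \<le> c * (1 / real (Suc n))"
    using assms by (intro always_eventually allI)
  have "(\<lambda>n. c * (1 / real (Suc n))) \<longlonglongrightarrow> c * 0"
    by (intro tendsto_intros LIMSEQ_Suc[OF lim_1_over_n])
  then show "(\<lambda>n. c * (1 / real (Suc n))) \<longlonglongrightarrow> 0" by simp
qed

text \<open>The form is only semidefinite: functions are total, and an integral over a domain
  ignores their values elsewhere, so \<open>nrm f = 0\<close> does not force \<open>f\<close> to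
  vanish.\<close>

locale prehilbert =
  fixes V :: "('x \<Rightarrow> complex) set" and ip :: "('x \<Rightarrow> complex) \<Rightarrow> ('x \<Rightarrow> complex) \<Rightarrow> complex"
  assumes V_nonempty: "V \<noteq> {}"
    and V_lin: "\<And>f g a b. f \<in> V \<Longrightarrow> g \<in> V \<Longrightarrow> (\<lambda>x. a * f x + b * g x) \<in> V"
    and ip_lin: "\<And>f g h a b. f \<in> V \<Longrightarrow> g \<in> V \<Longrightarrow> h \<in> V \<Longrightarrow>
        ip (\<lambda>x. a * f x + b * g x) h = a * ip f h + b * ip g h"
    and ip_cnj: "\<And>f g. f \<in> V \<Longrightarrow> g \<in> V \<Longrightarrow> ip g f = cnj (ip f g)"
    and ip_nonneg: "\<And>f. f \<in> V \<Longrightarrow> 0 \<le> Re (ip f f)"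
begin

definition nrm :: "('x \<Rightarrow> complex) \<Rightarrow> real" where
  "nrm f = sqrt (Re (ip f f))"

text \<open>Restricted to \<open>V\<close> because functionals such as
  \<open>f \<mapsto> grad_app f z u\<close> are linear only where derivatives exist.\<close>

definition lin :: "(('x \<Rightarrow> complex) \<Rightarrow> complex) \<Rightarrow> bool" where
  "lin L \<longleftrightarrow> (\<forall>f\<in>V. \<forall>g\<in>V. \<forall>a b. L (\<lambda>x. a * f x + b * g x) = a * L f + b * L g)"

text \<open>The sign of \<open>C\<close> is demanded separately, since the inequalities leave it
  open when the seminorm vanishes on all of \<open>V\<close>.\<close>

definition bnd :: "real \<Rightarrow> (('x \<Rightarrow> complex) \<Rightarrow> complex) \<Rightarrow> bool" where
  "bnd C L \<longleftrightarrow> 0 \<le> C \<and> (\<forall>f\<in>V. cmod (L f) \<le> C * nrm f)"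

definition dual :: "(('x \<Rightarrow> complex) \<Rightarrow> complex) set" where
  "dual = {L. lin L \<and> (\<exists>C. bnd C L)}"

lemma nrm_nonneg [simp]: "f \<in> V \<Longrightarrow> 0 \<le> nrm f"
  by (simp add: nrm_def ip_nonneg)

lemma ip_self: "f \<in> V \<Longrightarrow> ip f f = of_real ((nrm f)\<^sup>2)"
  using ip_cnj[of f f] by (simp add: nrm_def ip_nonneg complex_eq_iff)

lemma ip_lin_right:
  assumes "f \<in> V" "g \<in> V" "h \<in> V"
  shows "ip h (\<lambda>x. a * f x + b * g x) = cnj a * ip h f + cnj b * ip h g"
proof -
  have "ip h (\<lambda>x. a * f x + b * g x) = cnj (ip (\<lambda>x. a * f x + b * g x) h)"
    using assms by (intro ip_cnj V_lin)
  also have "\<dots> = cnj a * cnj (ip f h) + cnj b * cnj (ip g h)"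
    using assms by (simp add: ip_lin)
  also have "\<dots> = cnj a * ip h f + cnj b * ip h g"
    using assms by (simp add: ip_cnj[of _ h])
  finally show ?thesis .
qed

lemma V_scale: "f \<in> V \<Longrightarrow> (\<lambda>x. a * f x) \<in> V"
  using V_lin[of f f a 0] by simp

lemma ip_scale: "f \<in> V \<Longrightarrow> h \<in> V \<Longrightarrow> ip (\<lambda>x. a * f x) h = a * ip f h"
  using ip_lin[of f f h a 0] by simp

text \<open>The coefficient \<open>1\<close> stays unsimplified so that the sum matches the pattern
  of \<open>V_lin\<close>, \<open>ip_lin\<close> and \<open>dual_lin\<close>.\<close>

lemma nrm_sq_add:
  assumes "f \<in> V" "g \<in> V"
  shows "(nrm (\<lambda>x. 1 * f x + a * g x))\<^sup>2 = (nrm f)\<^sup>2 + 2 * Re (a * ip g f) + (cmod a)\<^sup>2 * (nrm g)\<^sup>2"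
proof -
  let ?h = "\<lambda>x. 1 * f x + a * g x"
  have h: "?h \<in> V" by (rule V_lin[OF assms])
  have "of_real ((nrm ?h)\<^sup>2) = ip ?h ?h" using ip_self[OF h] by simp
  also have "\<dots> = 1 * ip f ?h + a * ip g ?h" by (rule ip_lin[OF assms h])
  also have "ip f ?h = cnj 1 * ip f f + cnj a * ip f g"
    by (rule ip_lin_right[OF assms assms(1)])
  also have "ip g ?h = cnj 1 * ip g f + cnj a * ip g g"
    by (rule ip_lin_right[OF assms assms(2)])
  also have "ip f g = cnj (ip g f)" by (rule ip_cnj[OF assms(2,1)])
  also have "ip f f = of_real ((nrm f)\<^sup>2)" by (rule ip_self[OF assms(1)])
  also have "ip g g = of_real ((nrm g)\<^sup>2)" by (rule ip_self[OF assms(2)])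
  finally have "(nrm ?h)\<^sup>2 = Re (1 * (cnj 1 * of_real ((nrm f)\<^sup>2) + cnj a * cnj (ip g f)) +
       a * (cnj 1 * ip g f + cnj a * of_real ((nrm g)\<^sup>2)))"
    by (metis Re_complex_of_real)
  also have "\<dots> = (nrm f)\<^sup>2 + 2 * Re (a * ip g f) + Re (a * cnj a) * (nrm g)\<^sup>2"
    by (simp add: algebra_simps)
  also have "Re (a * cnj a) = (cmod a)\<^sup>2"
    by (metis Re_complex_of_real complex_norm_square)
  finally show ?thesis .
qed

lemma nrm_scale: "f \<in> V \<Longrightarrow> nrm (\<lambda>x. a * f x) = cmod a * nrm f"
proof -
  assume f: "f \<in> V"
  have "(nrm (\<lambda>x. a * f x))\<^sup>2 = Re (ip (\<lambda>x. a * f x) (\<lambda>x. a * f x))"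
    using ip_self[OF V_scale[OF f]] by simp
  also have "ip (\<lambda>x. a * f x) (\<lambda>x. a * f x) = a * (cnj a * ip f f)"
    using ip_lin_right[OF f f f, of a 0] ip_scale[OF f V_scale[OF f]] by simp
  also have "\<dots> = of_real ((cmod a * nrm f)\<^sup>2)"
    using ip_self[OF f] complex_norm_square[of a] by (simp add: power_mult_distrib)
  finally have "(nrm (\<lambda>x. a * f x))\<^sup>2 = (cmod a * nrm f)\<^sup>2" by simp
  then show ?thesis using f V_scale[OF f]
    by (metis abs_of_nonneg mult_nonneg_nonneg norm_ge_zero nrm_nonneg power2_abs power2_eq_iff_nonneg)
qed

lemma ip_Cauchy_Schwarz:
  assumes "f \<in> V" "g \<in> V"
  shows "cmod (ip f g) \<le> nrm f * nrm g"
proof -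
  obtain c where c: "cmod c = 1" "c * ip f g = of_real (cmod (ip f g))"
    using ex_unimodular_mult_eq_cmod by blast
  have "0 \<le> (nrm g)\<^sup>2 + 2 * cmod (ip f g) * t + (nrm f)\<^sup>2 * t\<^sup>2" for t :: real
  proof -
    have "0 \<le> (nrm (\<lambda>x. 1 * g x + (of_real t * c) * f x))\<^sup>2" by simp
    also have "\<dots> = (nrm g)\<^sup>2 + 2 * Re (of_real t * (c * ip f g)) + t\<^sup>2 * (nrm f)\<^sup>2"
      using c(1) by (subst nrm_sq_add[OF assms(2,1)]) (simp add: norm_mult mult.assoc)
    finally show ?thesis unfolding c(2) by (simp add: algebra_simps)
  qed
  then have "(cmod (ip f g))\<^sup>2 \<le> (nrm f)\<^sup>2 * (nrm g)\<^sup>2"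
    by (rule quadratic_nonneg_imp) simp
  then show ?thesis using assms
    by (metis mult_nonneg_nonneg nrm_nonneg power2_le_imp_le power_mult_distrib)
qed

lemma dual_lin: "L \<in> dual \<Longrightarrow> f \<in> V \<Longrightarrow> g \<in> V \<Longrightarrow> L (\<lambda>x. a * f x + b * g x) = a * L f + b * L g"
  by (auto simp: dual_def lin_def)

lemma dual_scale: "L \<in> dual \<Longrightarrow> f \<in> V \<Longrightarrow> L (\<lambda>x. a * f x) = a * L f"
  using dual_lin[of L f f a 0] by simp

lemma dual_bnd: "L \<in> dual \<Longrightarrow> \<exists>C. bnd C L"
  by (auto simp: dual_def)

lemma bnd_apply: "bnd C L \<Longrightarrow> f \<in> V \<Longrightarrow> cmod (L f) \<le> C * nrm f"
  by (simp add: bnd_def)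

lemma bnd_nonneg: "bnd C L \<Longrightarrow> 0 \<le> C"
  by (simp add: bnd_def)

lemma bnd_le: "bnd C L \<Longrightarrow> C \<le> C' \<Longrightarrow> bnd C' L"
  unfolding bnd_def by (meson mult_right_mono nrm_nonneg order_trans)

lemma bnd_lincomb:
  assumes "bnd C L" "bnd C' M"
  shows "bnd (cmod a * C + cmod b * C') (\<lambda>f. a * L f + b * M f)"
  unfolding bnd_def
proof (intro conjI ballI)
  fix f assume f: "f \<in> V"
  have "cmod (a * L f + b * M f) \<le> cmod a * cmod (L f) + cmod b * cmod (M f)"
    by (metis norm_mult norm_triangle_ineq)
  also have "\<dots> \<le> cmod a * (C * nrm f) + cmod b * (C' * nrm f)"
    using assms f by (intro add_mono mult_left_mono) (auto simp: bnd_def)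
  finally show "cmod (a * L f + b * M f) \<le> (cmod a * C + cmod b * C') * nrm f"
    by (simp add: algebra_simps)
qed (use assms in \<open>auto simp: bnd_def\<close>)

lemma dual_lincomb:
  assumes "L \<in> dual" "M \<in> dual"
  shows "(\<lambda>f. a * L f + b * M f) \<in> dual"
proof -
  obtain C C' where "bnd C L" "bnd C' M" using assms by (auto simp: dual_def)
  from bnd_lincomb[OF this] show ?thesis using assms
    by (auto simp: dual_def lin_def algebra_simps)
qed

text \<open>Any near-minimiser of \<open>\<parallel>f\<parallel>\<^sup>2 - 2 Re (L f)\<close> nearly represents \<open>L\<close>;
  an exact representer would require completeness.\<close>

lemma approx_representer:
  assumes L: "L \<in> dual" and e: "0 < e"
  shows "\<exists>f\<in>V. \<forall>g\<in>V. cmod (L g - ip g f) \<le> e * nrm g"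
proof -
  obtain C where C: "bnd C L" using dual_bnd[OF L] by blast
  define J where "J f = (nrm f)\<^sup>2 - 2 * Re (L f)" for f
  have low: "- C\<^sup>2 \<le> J f" if f: "f \<in> V" for f
  proof -
    have "Re (L f) \<le> C * nrm f"
      using C f complex_Re_le_cmod[of "L f"] by (fastforce simp: bnd_def)
    moreover have "0 \<le> (nrm f - C)\<^sup>2" by simp
    ultimately show ?thesis by (simp add: J_def power2_diff algebra_simps)
  qed
  have bdd: "bdd_below (J ` V)" using low by (auto intro!: bdd_belowI)
  \<comment> \<open>The tolerance is \<open>e\<^sup>2\<close> because the discriminant inequality
    below bounds the square of the error.\<close>
  obtain f where f: "f \<in> V" "J f < Inf (J ` V) + e\<^sup>2"
    using cInf_lessD[of "J ` V" "Inf (J ` V) + e\<^sup>2"] V_nonempty e by auto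
  show ?thesis
  proof (intro bexI ballI)
    fix g assume g: "g \<in> V"
    obtain c where c: "cmod c = 1" "c * (ip g f - L g) = of_real (cmod (ip g f - L g))"
      using ex_unimodular_mult_eq_cmod by blast
    \<comment> \<open>Moving from \<open>f\<close> by \<open>t * c * g\<close> lowers
      \<open>J\<close> by at most \<open>e\<^sup>2\<close>; the change of \<open>J\<close> is the
      rest of this quadratic in \<open>t\<close>.\<close>
    have "0 \<le> e\<^sup>2 + 2 * cmod (ip g f - L g) * t + (nrm g)\<^sup>2 * t\<^sup>2" for t :: real
    proof -
      let ?h = "\<lambda>x. 1 * f x + (of_real t * c) * g x"
      have h: "?h \<in> V" by (rule V_lin[OF f(1) g])
      have "J f - e\<^sup>2 \<le> J ?h"
        using f(2) cInf_lower[OF imageI[OF h] bdd] by linarith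
      also have "J ?h = (nrm f)\<^sup>2 + 2 * Re (of_real t * c * ip g f) + t\<^sup>2 * (nrm g)\<^sup>2
          - 2 * Re (L f + of_real t * c * L g)"
        unfolding J_def using c(1) dual_lin[OF L f(1) g, of 1 "of_real t * c"]
        by (subst nrm_sq_add[OF f(1) g]) (simp add: norm_mult)
      also have "\<dots> = J f + 2 * Re (of_real t * (c * (ip g f - L g))) + t\<^sup>2 * (nrm g)\<^sup>2"
        unfolding J_def by (simp add: algebra_simps)
      finally show ?thesis unfolding c(2) by (simp add: algebra_simps)
    qed
    then have "(cmod (ip g f - L g))\<^sup>2 \<le> (nrm g)\<^sup>2 * e\<^sup>2"
      by (rule quadratic_nonneg_imp) simp
    then show "cmod (L g - ip g f) \<le> e * nrm g" using g e
      by (metis less_eq_real_def mult.commute mult_nonneg_nonneg norm_minus_commute nrm_nonneg power2_le_imp_le power_mult_distrib)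
  qed (rule f)
qed

section \<open>The inner product of the dual\<close>

definition rep :: "(('x \<Rightarrow> complex) \<Rightarrow> complex) \<Rightarrow> nat \<Rightarrow> ('x \<Rightarrow> complex)" where
  "rep L n = (SOME f. f \<in> V \<and> (\<forall>g\<in>V. cmod (L g - ip g f) \<le> 1 / real (Suc n) * nrm g))"

text \<open>\<open>B M L\<close> is \<open>M\<close> applied to the Riesz representer of \<open>L\<close> in the completion.\<close>

definition B :: "(('x \<Rightarrow> complex) \<Rightarrow> complex) \<Rightarrow> (('x \<Rightarrow> complex) \<Rightarrow> complex) \<Rightarrow> complex" where
  "B M L = lim (\<lambda>n. M (rep L n))"

lemma rep:
  assumes "L \<in> dual"
  shows rep_in: "rep L n \<in> V"
    and rep_approx: "\<And>g. g \<in> V \<Longrightarrow> cmod (L g - ip g (rep L n)) \<le> 1 / real (Suc n) * nrm g"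
proof -
  have "\<exists>f. f \<in> V \<and> (\<forall>g\<in>V. cmod (L g - ip g f) \<le> 1 / real (Suc n) * nrm g)"
    using approx_representer[OF assms, of "1 / real (Suc n)"] by auto
  from someI_ex[OF this, folded rep_def]
  show "rep L n \<in> V" "\<And>g. g \<in> V \<Longrightarrow> cmod (L g - ip g (rep L n)) \<le> 1 / real (Suc n) * nrm g"
    by auto
qed

text \<open>Apply the approximate representation to the representer itself and divide by its
  norm.\<close>

lemma nrm_rep_le:
  assumes L: "L \<in> dual" and C: "bnd C L"
  shows "nrm (rep L n) \<le> C + 1 / real (Suc n)"
proof -
  let ?f = "rep L n"
  note f = rep_in[OF L, of n]
  have "(nrm ?f)\<^sup>2 = cmod (ip ?f ?f)" unfolding ip_self[OF f] norm_of_real by simp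
  also have "\<dots> \<le> cmod (L ?f) + cmod (L ?f - ip ?f ?f)"
    by (metis norm_minus_commute norm_triangle_sub)
  also have "\<dots> \<le> C * nrm ?f + 1 / real (Suc n) * nrm ?f"
    using C f rep_approx[OF L f] by (intro add_mono) (auto simp: bnd_def)
  finally have *: "nrm ?f * nrm ?f \<le> (C + 1 / real (Suc n)) * nrm ?f"
    by (simp add: power2_eq_square algebra_simps)
  have "0 \<le> C + 1 / real (Suc n)" using C by (simp add: bnd_def)
  then show ?thesis using * nrm_nonneg[OF f] by (cases "nrm ?f = 0") auto
qed

text \<open>Both vectors nearly represent the same functional, so their difference is nearly
  orthogonal to every vector, in particular to itself. Hence the representers form a Cauchy
  sequence.\<close>

lemma nrm_rep_diff:
  assumes L: "L \<in> dual"
  shows "nrm (\<lambda>x. 1 * rep L n x + (-1) * rep L m x) \<le> 1 / real (Suc n) + 1 / real (Suc m)"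
proof -
  let ?g = "\<lambda>x. 1 * rep L n x + (-1) * rep L m x"
  note f = rep_in[OF L, of n] rep_in[OF L, of m]
  have g: "?g \<in> V" by (rule V_lin[OF f])
  have "(nrm ?g)\<^sup>2 = cmod (ip ?g ?g)" unfolding ip_self[OF g] norm_of_real by simp
  also have "ip ?g ?g = cnj 1 * ip ?g (rep L n) + cnj (-1) * ip ?g (rep L m)"
    by (rule ip_lin_right[OF f g])
  also have "\<dots> = (L ?g - ip ?g (rep L m)) - (L ?g - ip ?g (rep L n))" by simp
  also have "cmod \<dots> \<le> 1 / real (Suc m) * nrm ?g + 1 / real (Suc n) * nrm ?g"
    by (intro order_trans[OF norm_triangle_ineq4] add_mono rep_approx L g)
  finally have *: "nrm ?g * nrm ?g \<le> (1 / real (Suc n) + 1 / real (Suc m)) * nrm ?g"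
    by (simp add: power2_eq_square algebra_simps)
  then show ?thesis using nrm_nonneg[OF g] by (cases "nrm ?g = 0") auto
qed

text \<open>A bounded functional maps the Cauchy sequence of representers to a Cauchy sequence of
  complex numbers, so the limit is taken in the scalars and not in \<open>V\<close>.\<close>

lemma B_tendsto:
  assumes L: "L \<in> dual" and M: "M \<in> dual"
  shows "(\<lambda>n. M (rep L n)) \<longlonglongrightarrow> B M L"
proof -
  obtain C where C: "bnd C M" using dual_bnd[OF M] by blast
  have est: "cmod (M (rep L n) - M (rep L m)) \<le> C * (1 / real (Suc n) + 1 / real (Suc m))" for n m
  proof -
    let ?g = "\<lambda>x. 1 * rep L n x + (-1) * rep L m x"
    have eq: "M (rep L n) - M (rep L m) = M ?g"
      using dual_lin[OF M rep_in[OF L, of n] rep_in[OF L, of m], of 1 "-1"] by simp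
    have "cmod (M (rep L n) - M (rep L m)) \<le> C * nrm ?g"
      unfolding eq by (rule bnd_apply[OF C V_lin[OF rep_in[OF L, of n] rep_in[OF L, of m]]])
    also have "\<dots> \<le> C * (1 / real (Suc n) + 1 / real (Suc m))"
      using C nrm_rep_diff[OF L] by (intro mult_left_mono) (auto simp: bnd_def)
    finally show ?thesis .
  qed
  have C0: "0 \<le> C" using C by (simp add: bnd_def)
  have "Cauchy (\<lambda>n. M (rep L n))"
  proof (rule metric_CauchyI)
    fix e :: real assume e: "0 < e"
    \<comment> \<open>\<open>C + 1\<close> instead of \<open>C\<close> keeps the denominator
      positive when \<open>C = 0\<close>.\<close>
    obtain N where N: "inverse (real (Suc N)) < e / (2 * (C + 1))"
      using reals_Archimedean[of "e / (2 * (C + 1))"] e C0 by auto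
    have small: "1 / real (Suc k) < e / (2 * (C + 1))" if "N \<le> k" for k
    proof -
      have "inverse (real (Suc k)) \<le> inverse (real (Suc N))"
        using that by (intro le_imp_inverse_le) auto
      then show ?thesis using N by (simp only: inverse_eq_divide)
    qed
    show "\<exists>N. \<forall>m\<ge>N. \<forall>n\<ge>N. dist (M (rep L m)) (M (rep L n)) < e"
    proof (intro exI allI impI)
      fix m n assume mn: "N \<le> m" "N \<le> n"
      have "1 / real (Suc m) + 1 / real (Suc n) \<le> 2 * (e / (2 * (C + 1)))"
        using small[OF mn(1)] small[OF mn(2)] by linarith
      also have "\<dots> = e / (C + 1)" using C0 by (simp add: field_simps)
      finally have "C * (1 / real (Suc m) + 1 / real (Suc n)) \<le> C * (e / (C + 1))"
        using C0 by (intro mult_left_mono)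
      also have "\<dots> < e" using C0 e by (simp add: field_simps)
      finally show "dist (M (rep L m)) (M (rep L n)) < e"
        using est[of m n] by (simp add: dist_norm)
    qed
  qed
  then show ?thesis unfolding B_def by (simp add: Cauchy_convergent_iff convergent_LIMSEQ_iff)
qed

text \<open>The choice made by \<open>rep\<close> depends on \<open>L\<close> only through its
  values on \<open>V\<close>. This allows replacing a functional by one that agrees with it on the
  Bergman space alone, such as a complex derivative by \<open>grad_app\<close>.\<close>

lemma B_cong:
  assumes "L \<in> dual" "\<And>f. f \<in> V \<Longrightarrow> M f = M' f" "\<And>f. f \<in> V \<Longrightarrow> L f = L' f"
  shows "B M L = B M' L'"
proof -
  have "rep L n = rep L' n" for n
    unfolding rep_def using assms(3) by (intro arg_cong[where f=Eps] ext) auto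
  moreover have "M (rep L n) = M' (rep L n)" for n
    by (rule assms(2)[OF rep_in[OF assms(1)]])
  ultimately show ?thesis by (simp add: B_def)
qed

lemma B_lin_left:
  assumes "L \<in> dual" "M \<in> dual" "P \<in> dual"
  shows "B (\<lambda>f. a * L f + b * M f) P = a * B L P + b * B M P"
proof -
  have "(\<lambda>n. a * L (rep P n) + b * M (rep P n)) \<longlonglongrightarrow> a * B L P + b * B M P"
    by (intro tendsto_intros B_tendsto assms)
  from LIMSEQ_unique[OF B_tendsto[OF assms(3) dual_lincomb[OF assms(1,2)]] this] show ?thesis .
qed

lemma B_bound:
  assumes "L \<in> dual" "M \<in> dual" "bnd C M" "bnd C' L"
  shows "cmod (B M L) \<le> C * C'"
proof -
  have "cmod (M (rep L n)) \<le> C * (C' + 1 / real (Suc n))" for n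
    by (rule order_trans[OF bnd_apply[OF assms(3) rep_in[OF assms(1)]]
          mult_left_mono[OF nrm_rep_le[OF assms(1,4)] bnd_nonneg[OF assms(3)]]])
  moreover have "(\<lambda>n. C * (C' + 1 / real (Suc n))) \<longlonglongrightarrow> C * (C' + 0)"
    by (intro tendsto_intros LIMSEQ_Suc[OF lim_1_over_n])
  ultimately show ?thesis
    using LIMSEQ_le[OF tendsto_norm[OF B_tendsto[OF assms(1,2)]]] by auto
qed

text \<open>Both sides are limits of quantities close to
  \<open>ip (rep M n) (rep L n)\<close>.\<close>

lemma B_cnj:
  assumes L: "L \<in> dual" and M: "M \<in> dual"
  shows "B L M = cnj (B M L)"
proof -
  obtain C C' where C: "bnd C L" and C': "bnd C' M" using dual_bnd L M by blast
  have "cmod (L (rep M n) - cnj (M (rep L n))) \<le> (C + C' + 2) * (1 / real (Suc n))" for n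
  proof -
    note f = rep_in[OF L, of n] and g = rep_in[OF M, of n]
    have le1: "1 / real (Suc n) \<le> 1" by simp
    have eq: "L (rep M n) - cnj (M (rep L n)) =
       (L (rep M n) - ip (rep M n) (rep L n)) - cnj (M (rep L n) - ip (rep L n) (rep M n))"
      using ip_cnj[OF f g] by simp
    have "cmod (L (rep M n) - cnj (M (rep L n)))
        \<le> 1 / real (Suc n) * nrm (rep M n) + 1 / real (Suc n) * nrm (rep L n)"
      unfolding eq by (rule order_trans[OF norm_triangle_ineq4 add_mono])
         (simp_all only: complex_mod_cnj rep_approx[OF L g] rep_approx[OF M f])
    also have "\<dots> \<le> 1 / real (Suc n) * (C' + 1) + 1 / real (Suc n) * (C + 1)"
      using order_trans[OF nrm_rep_le[OF M C', of n] add_left_mono[OF le1]]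
            order_trans[OF nrm_rep_le[OF L C, of n] add_left_mono[OF le1]]
      by (intro add_mono mult_left_mono) auto
    also have "\<dots> = (C + C' + 2) * (1 / real (Suc n))"
      by (simp only: distrib_left distrib_right mult.commute[of "1 / real (Suc n)"])
    finally show ?thesis .
  qed
  then have "(\<lambda>n. L (rep M n) - cnj (M (rep L n))) \<longlonglongrightarrow> 0"
    by (rule tendsto_zero_of_bound)
  moreover have "(\<lambda>n. L (rep M n) - cnj (M (rep L n))) \<longlonglongrightarrow> B L M - cnj (B M L)"
    by (intro tendsto_intros B_tendsto L M)
  ultimately show ?thesis by (metis LIMSEQ_unique eq_iff_diff_eq_0)
qed

text \<open>The chosen representers need not be additive in the functional, so linearity in this
  argument is taken from the other one by conjugate symmetry.\<close>

lemma B_lin_right: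
  assumes "L \<in> dual" "M \<in> dual" "P \<in> dual"
  shows "B P (\<lambda>f. a * L f + b * M f) = cnj a * B P L + cnj b * B P M"
proof -
  have "B P (\<lambda>f. a * L f + b * M f) = cnj (B (\<lambda>f. a * L f + b * M f) P)"
    by (rule B_cnj[OF assms(3) dual_lincomb[OF assms(1,2)]])
  also have "\<dots> = cnj a * cnj (B L P) + cnj b * cnj (B M P)"
    by (simp add: B_lin_left[OF assms])
  also have "\<dots> = cnj a * B P L + cnj b * B P M"
    using B_cnj[OF assms(3,1)] B_cnj[OF assms(3,2)] by simp
  finally show ?thesis .
qed

text \<open>Testing \<open>L\<close> on its own representer gives
  \<open>ip (rep L n) (rep L n)\<close> up to an error tending to 0, so the squared norms of the
  representers converge to \<open>B L L\<close>.\<close>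

lemma
  assumes L: "L \<in> dual"
  shows nrm_rep_tendsto: "(\<lambda>n. (nrm (rep L n))\<^sup>2) \<longlonglongrightarrow> Re (B L L)"
    and B_self: "B L L = of_real (Re (B L L))"
    and B_self_nonneg: "0 \<le> Re (B L L)"
proof -
  obtain C where C: "bnd C L" using dual_bnd L by blast
  have "cmod (L (rep L n) - ip (rep L n) (rep L n)) \<le> (C + 1) * (1 / real (Suc n))" for n
  proof -
    have "cmod (L (rep L n) - ip (rep L n) (rep L n)) \<le> 1 / real (Suc n) * nrm (rep L n)"
      by (rule rep_approx[OF L rep_in[OF L]])
    also have "\<dots> \<le> 1 / real (Suc n) * (C + 1)"
      using nrm_rep_le[OF L C, of n] by (intro mult_left_mono) (auto intro: order_trans)
    finally show ?thesis by (simp add: mult.commute)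
  qed
  then have "(\<lambda>n. L (rep L n) - ip (rep L n) (rep L n)) \<longlonglongrightarrow> 0"
    by (rule tendsto_zero_of_bound)
  from tendsto_diff[OF B_tendsto[OF L L] this]
  have "(\<lambda>n. of_real ((nrm (rep L n))\<^sup>2)) \<longlonglongrightarrow> B L L"
    by (simp add: ip_self[OF rep_in[OF L]])
  from tendsto_Re[OF this] show lim: "(\<lambda>n. (nrm (rep L n))\<^sup>2) \<longlonglongrightarrow> Re (B L L)" by simp
  show "B L L = of_real (Re (B L L))"
    using B_cnj[OF L L] by (simp add: complex_eq_iff)
  show "0 \<le> Re (B L L)" by (rule LIMSEQ_le_const[OF lim]) auto
qed

text \<open>Cauchy-Schwarz against an approximate representer, followed by the limit.\<close>

lemma dual_norm_bound:
  assumes L: "L \<in> dual" and f: "f \<in> V"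
  shows "(cmod (L f))\<^sup>2 \<le> Re (B L L) * (nrm f)\<^sup>2"
proof -
  \<comment> \<open>The norm is written as the root of its square because the known limit is that of
    the squares.\<close>
  have "cmod (L f) \<le> (sqrt ((nrm (rep L n))\<^sup>2) + 1 / real (Suc n)) * nrm f" for n
  proof -
    have "cmod (L f) \<le> cmod (ip f (rep L n)) + cmod (L f - ip f (rep L n))"
      by (rule norm_triangle_sub)
    also have "\<dots> \<le> nrm f * nrm (rep L n) + 1 / real (Suc n) * nrm f"
      by (intro add_mono rep_approx ip_Cauchy_Schwarz L f rep_in)
    finally show ?thesis using rep_in[OF L, of n] by (simp add: algebra_simps)
  qed
  moreover have "(\<lambda>n. (sqrt ((nrm (rep L n))\<^sup>2) + 1 / real (Suc n)) * nrm f)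
      \<longlonglongrightarrow> (sqrt (Re (B L L)) + 0) * nrm f"
    by (intro tendsto_intros LIMSEQ_Suc[OF lim_1_over_n] nrm_rep_tendsto L)
  ultimately have "cmod (L f) \<le> sqrt (Re (B L L)) * nrm f"
    using LIMSEQ_le_const by fastforce
  then have "(cmod (L f))\<^sup>2 \<le> (sqrt (Re (B L L)) * nrm f)\<^sup>2"
    by (intro power_mono) auto
  then show ?thesis using B_self_nonneg[OF L] by (simp add: power_mult_distrib)
qed

text \<open>In general the supremum is reached only in the limit along \<open>rep L n\<close>. An
  upper bound \<open>y\<close> scales to all of \<open>V\<close>; on the representers it gives
  \<open>(B L L)\<^sup>2 \<le> y * B L L\<close> in the limit. The zero function supplies
  \<open>0 \<le> y\<close> for the case that \<open>B L L\<close> vanishes.\<close>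

lemma dual_norm_Sup:
  assumes L: "L \<in> dual"
  shows "Sup {(cmod (L f))\<^sup>2 | f. f \<in> V \<and> nrm f \<le> 1} = Re (B L L)"
proof (rule cSup_eq_non_empty)
  obtain f0 where f0: "f0 \<in> V" using V_nonempty by blast
  have zero: "(\<lambda>x. 0) \<in> V" "nrm (\<lambda>x. 0) = 0" "L (\<lambda>x. 0) = 0"
    using V_scale[OF f0, of 0] nrm_scale[OF f0, of 0] dual_scale[OF L f0, of 0] by auto
  then show "{(cmod (L f))\<^sup>2 | f. f \<in> V \<and> nrm f \<le> 1} \<noteq> {}"
    by (metis (mono_tags, lifting) Collect_empty_eq zero_le_one)
  fix y
  assume "y \<in> {(cmod (L f))\<^sup>2 | f. f \<in> V \<and> nrm f \<le> 1}"
  then obtain f where f: "f \<in> V" "nrm f \<le> 1" "y = (cmod (L f))\<^sup>2" by blast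
  have "y \<le> Re (B L L) * (nrm f)\<^sup>2" unfolding f(3) by (rule dual_norm_bound[OF L f(1)])
  also have "\<dots> \<le> Re (B L L) * 1\<^sup>2"
    using f B_self_nonneg[OF L] by (intro mult_left_mono power_mono) auto
  finally show "y \<le> Re (B L L)" by simp
next
  fix y assume y: "\<And>x. x \<in> {(cmod (L f))\<^sup>2 | f. f \<in> V \<and> nrm f \<le> 1} \<Longrightarrow> x \<le> y"
  obtain f0 where f0: "f0 \<in> V" using V_nonempty by blast
  have "0 \<le> y"
    using y[of "(cmod (L (\<lambda>x. 0)))\<^sup>2"] V_scale[OF f0, of 0] nrm_scale[OF f0, of 0] dual_scale[OF L f0, of 0]
    by force
  have "(cmod (L f))\<^sup>2 \<le> y * (nrm f)\<^sup>2" if f: "f \<in> V" for f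
  proof (cases "nrm f = 0")
    case True
    then show ?thesis using dual_norm_bound[OF L f] by simp
  next
    case False
    let ?g = "\<lambda>x. of_real (1 / nrm f) * f x"
    have "nrm ?g = 1" using nrm_scale[OF f, of "of_real (1 / nrm f)"] False nrm_nonneg[OF f]
      by (simp add: norm_divide)
    then have "(cmod (L ?g))\<^sup>2 \<le> y" using V_scale[OF f, of "of_real (1 / nrm f)"] by (intro y) force
    moreover have "L ?g = of_real (1 / nrm f) * L f" by (rule dual_scale[OF L f])
    ultimately have "(cmod (L f))\<^sup>2 / (nrm f)\<^sup>2 \<le> y"
      by (simp only: norm_mult norm_of_real power_mult_distrib power2_abs) (simp add: power_divide)
    then show ?thesis using False by (simp add: divide_le_eq)
  qed
  then have "(cmod (L (rep L n)))\<^sup>2 \<le> y * (nrm (rep L n))\<^sup>2" for n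
    using rep_in[OF L] by blast
  moreover have "(\<lambda>n. (cmod (L (rep L n)))\<^sup>2) \<longlonglongrightarrow> (cmod (B L L))\<^sup>2"
    by (intro tendsto_intros B_tendsto L)
  moreover have "(\<lambda>n. y * (nrm (rep L n))\<^sup>2) \<longlonglongrightarrow> y * Re (B L L)"
    by (intro tendsto_intros nrm_rep_tendsto L)
  ultimately have "(cmod (B L L))\<^sup>2 \<le> y * Re (B L L)"
    by (intro LIMSEQ_le) auto
  then have "Re (B L L) * Re (B L L) \<le> y * Re (B L L)"
    using B_self[OF L] by (metis norm_of_real power2_abs power2_eq_square)
  then show "Re (B L L) \<le> y" using B_self_nonneg[OF L] \<open>0 \<le> y\<close>
    by (cases "Re (B L L) = 0") auto
qed

section \<open>Differentiation along curves in the dual\<close>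

definition dual_deriv :: "(real \<Rightarrow> ('x \<Rightarrow> complex) \<Rightarrow> complex) \<Rightarrow> (('x \<Rightarrow> complex) \<Rightarrow> complex) \<Rightarrow> real \<Rightarrow> bool" where
  "dual_deriv X X' t \<longleftrightarrow> (\<exists>C d. 0 < d \<and> (\<forall>h. \<bar>h\<bar> < d \<longrightarrow> X (t + h) \<in> dual \<and>
     bnd (C * h\<^sup>2) (\<lambda>f. X (t + h) f - (X t f + of_real h * X' f))))"

text \<open>The product rule. The parameter is real, so the conjugation in the second argument
  leaves increments unchanged. Asking for quadratic remainders in \<open>dual_deriv\<close> reduces
  the proof to expanding \<open>B\<close> and bounding three terms; Taylor's theorem will supply
  such remainders.\<close>

lemma B_has_vector_derivative:
  assumes X: "dual_deriv X X' t" and Y: "dual_deriv Y Y' t"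
    and X': "X' \<in> dual" and Y': "Y' \<in> dual"
  shows "((\<lambda>s. B (X s) (Y s)) has_vector_derivative (B X' (Y t) + B (X t) Y')) (at t)"
proof -
  obtain C d where d: "0 < d" and Xd: "\<And>h. \<bar>h\<bar> < d \<Longrightarrow> X (t + h) \<in> dual"
    and Xb: "\<And>h. \<bar>h\<bar> < d \<Longrightarrow> bnd (C * h\<^sup>2) (\<lambda>f. X (t + h) f - (X t f + of_real h * X' f))"
    using X unfolding dual_deriv_def by blast
  obtain C' d' where d': "0 < d'" and Yd: "\<And>h. \<bar>h\<bar> < d' \<Longrightarrow> Y (t + h) \<in> dual"
    and Yb: "\<And>h. \<bar>h\<bar> < d' \<Longrightarrow> bnd (C' * h\<^sup>2) (\<lambda>f. Y (t + h) f - (Y t f + of_real h * Y' f))"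
    using Y unfolding dual_deriv_def by blast
  have Xt: "X t \<in> dual" and Yt: "Y t \<in> dual" using Xd[of 0] Yd[of 0] d d' by auto
  obtain a where a: "bnd a (X t)" using dual_bnd[OF Xt] by blast
  obtain a' where a': "bnd a' X'" using dual_bnd[OF X'] by blast
  obtain b where b: "bnd b (Y t)" using dual_bnd[OF Yt] by blast
  obtain b' where b': "bnd b' Y'" using dual_bnd[OF Y'] by blast
  define e where "e = min 1 (min d d')"
  have e: "0 < e" using d d' by (simp add: e_def)
  have C0: "0 \<le> C"
  proof -
    have "0 \<le> C * (d/2)\<^sup>2" using Xb[of "d/2"] d by (auto simp: bnd_def)
    then show ?thesis using d by (simp add: zero_le_mult_iff)
  qed
  have C'0: "0 \<le> C'"
  proof -
    have "0 \<le> C' * (d'/2)\<^sup>2" using Yb[of "d'/2"] d' by (auto simp: bnd_def)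
    then show ?thesis using d' by (simp add: zero_le_mult_iff)
  qed
  \<comment> \<open>The summands belong, in this order, to the remainder of \<open>X\<close> against
    \<open>Y (t + h)\<close>, the affine part of \<open>X\<close> against the remainder of
    \<open>Y\<close>, and the cross term \<open>B X' Y'\<close>. The restriction to |h| < 1 built
    into \<open>e\<close> makes the bounds of the affine parts independent of
    \<open>h\<close>.\<close>
  define K where "K = C * (C' + b + b') + (a + a') * C' + a' * b'"
  have est: "cmod (B (X (t + h)) (Y (t + h)) - B (X t) (Y t) - of_real h * (B X' (Y t) + B (X t) Y')) \<le> K * h\<^sup>2"
    if h: "\<bar>h\<bar> < e" for h
  proof -
    have h1: "\<bar>h\<bar> \<le> 1" "\<bar>h\<bar> < d" "\<bar>h\<bar> < d'" using h by (auto simp: e_def)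
    have h2: "h\<^sup>2 \<le> 1" using h1(1) by (simp add: abs_square_le_1)
    define P where "P = (\<lambda>f. 1 * X t f + of_real h * X' f)"
    define Q where "Q = (\<lambda>f. 1 * Y t f + of_real h * Y' f)"
    define R where "R = (\<lambda>f. 1 * X (t + h) f + (-1) * P f)"
    define S where "S = (\<lambda>f. 1 * Y (t + h) f + (-1) * Q f)"
    have P: "P \<in> dual" and Q: "Q \<in> dual" unfolding P_def Q_def by (intro dual_lincomb Xt Yt X' Y')+
    have R: "R \<in> dual" and S: "S \<in> dual" unfolding R_def S_def by (intro dual_lincomb Xd Yd h1 P Q)+
    have Pb: "bnd (a + a') P"
      by (rule bnd_le[OF bnd_lincomb[OF a a', of 1 "of_real h", folded P_def]])
         (use h1 a' in \<open>auto simp: bnd_def mult_left_le_one_le\<close>)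
    have Qb: "bnd (b + b') Q"
      by (rule bnd_le[OF bnd_lincomb[OF b b', of 1 "of_real h", folded Q_def]])
         (use h1 b' in \<open>auto simp: bnd_def mult_left_le_one_le\<close>)
    have Req: "R = (\<lambda>f. X (t + h) f - (X t f + of_real h * X' f))"
      and Seq: "S = (\<lambda>f. Y (t + h) f - (Y t f + of_real h * Y' f))"
      by (auto simp: R_def S_def P_def Q_def)
    have Rb: "bnd (C * h\<^sup>2) R" 
      using Xb[OF h1(2)] unfolding Req .
    have Sb: "bnd (C' * h\<^sup>2) S" 
      using Yb[OF h1(3)] unfolding Seq .
    have XP: "X (t + h) = (\<lambda>f. 1 * P f + 1 * R f)" and YQ: "Y (t + h) = (\<lambda>f. 1 * Q f + 1 * S f)"
      by (auto simp: R_def S_def)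
    have Yh: "Y (t + h) \<in> dual" by (rule Yd[OF h1(3)])
    have Yhb: "bnd (C' + b + b') (Y (t + h))"
      unfolding YQ
      by (rule bnd_le[OF bnd_lincomb[OF Qb Sb]]) (use mult_left_le[OF h2 C'0] in auto)
    have "B (X (t + h)) (Y (t + h)) = 1 * B P (Y (t + h)) + 1 * B R (Y (t + h))"
      by (subst XP) (rule B_lin_left[OF P R Yh])
    also have "B P (Y (t + h)) = cnj 1 * B P Q + cnj 1 * B P S"
      by (subst YQ) (rule B_lin_right[OF Q S P])
    also have "B P Q = cnj 1 * B P (Y t) + cnj (of_real h) * B P Y'"
      by (subst Q_def) (rule B_lin_right[OF Yt Y' P])
    also have "B P (Y t) = 1 * B (X t) (Y t) + of_real h * B X' (Y t)"
      by (subst P_def) (rule B_lin_left[OF Xt X' Yt])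
    also have "B P Y' = 1 * B (X t) Y' + of_real h * B X' Y'"
      by (subst P_def) (rule B_lin_left[OF Xt X' Y'])
    finally have eq: "B (X (t + h)) (Y (t + h)) - B (X t) (Y t) - of_real h * (B X' (Y t) + B (X t) Y')
       = of_real (h\<^sup>2) * B X' Y' + B P S + B R (Y (t + h))"
      by (simp add: algebra_simps power2_eq_square)
    have "cmod (B (X (t + h)) (Y (t + h)) - B (X t) (Y t) - of_real h * (B X' (Y t) + B (X t) Y'))
        \<le> h\<^sup>2 * cmod (B X' Y') + cmod (B P S) + cmod (B R (Y (t + h)))"
      unfolding eq by (intro order_trans[OF norm_triangle_ineq] add_mono) (auto simp: norm_mult norm_power)
    also have "\<dots> \<le> h\<^sup>2 * (a' * b') + (a + a') * (C' * h\<^sup>2) + C * h\<^sup>2 * (C' + b + b')"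
      by (intro add_mono mult_left_mono B_bound P S R Yh X' Y' Pb Sb Rb Yhb a' b') auto
    also have "\<dots> = K * h\<^sup>2" by (simp add: K_def algebra_simps)
    finally show ?thesis .
  qed
  let ?g = "\<lambda>s. B (X s) (Y s)" and ?D = "B X' (Y t) + B (X t) Y'"
  have "((\<lambda>h. norm (?g (t + h) - ?g t - h *\<^sub>R ?D) / norm h) \<longlongrightarrow> 0) (at 0)"
  proof (rule Lim_null_comparison[where g="\<lambda>h. K * \<bar>h\<bar>"])
    have "\<forall>\<^sub>F h in at 0. h \<noteq> 0 \<and> \<bar>h\<bar> < e"
      using e by (auto simp: eventually_at intro!: exI[of _ e])
    then show "\<forall>\<^sub>F h in at 0. norm (norm (?g (t + h) - ?g t - h *\<^sub>R ?D) / norm h) \<le> K * \<bar>h\<bar>"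
    proof (rule eventually_mono)
      fix h assume h: "h \<noteq> 0 \<and> \<bar>h\<bar> < e"
      have "norm (?g (t + h) - ?g t - h *\<^sub>R ?D) \<le> K * \<bar>h\<bar> * \<bar>h\<bar>"
        using est[of h] h by (simp add: scaleR_conv_of_real power2_eq_square mult.assoc)
      then show "norm (norm (?g (t + h) - ?g t - h *\<^sub>R ?D) / norm h) \<le> K * \<bar>h\<bar>"
        using h by (simp add: divide_le_eq)
    qed
    show "((\<lambda>h. K * \<bar>h\<bar>) \<longlongrightarrow> 0) (at 0)" by (auto intro!: tendsto_eq_intros)
  qed
  then show ?thesis unfolding has_vector_derivative_def has_derivative_at
    by (simp add: bounded_linear_scaleR_left)
qed

end

subsection \<open>The mean value inequality on balls\<close>

text \<open>General in \<open>M\<close>, as it is applied both to Lebesgue measure and to its image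
  under an orthogonal map.\<close>

lemma nn_integral_translate:
  fixes M :: "'a::{second_countable_topology, real_normed_vector} measure"
  assumes "distr M borel ((+) c) = M" "f \<in> borel_measurable borel" "sets M = sets borel"
  shows "(\<integral>\<^sup>+x. f (c + x) \<partial>M) = (\<integral>\<^sup>+x. f x \<partial>M)"
proof -
  have "(\<integral>\<^sup>+x. f x \<partial>M) = (\<integral>\<^sup>+x. f x \<partial>distr M borel ((+) c))" using assms(1) by simp
  also have "\<dots> = (\<integral>\<^sup>+x. f (c + x) \<partial>M)"
    using assms
    by (intro nn_integral_distr)
       (auto simp: measurable_cong_sets[OF assms(3)] intro!: borel_measurable_continuous_onI continuous_intros)
  finally show ?thesis by simp
qed

text \<open>The image measure is translation invariant, hence a multiple of Lebesgue measure by Fubini;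
  both agree on the unit ball.\<close>

lemma lborel_distr_orthogonal_transformation:
  fixes T :: "'a::euclidean_space \<Rightarrow> 'a"
  assumes T: "orthogonal_transformation T"
  shows "distr lborel borel T = lborel"
proof -
  define N where "N = distr lborel borel T"
  have lin: "linear T" and nT: "\<And>x. norm (T x) = norm x"
    using T by (auto simp: orthogonal_transformation)
  have [measurable]: "T \<in> borel_measurable borel"
    using lin by (intro borel_measurable_continuous_onI linear_continuous_on linear_conv_bounded_linear[THEN iffD1])
  have sN [measurable_cong]: "sets N = sets borel" by (simp add: N_def)
  have spN: "space N = UNIV" by (simp add: N_def)
  have ball: "emeasure N (ball 0 r) = emeasure lborel (ball (0::'a) r)" for r
  proof -
    have "T -` ball 0 r = ball 0 r" by (auto simp: nT)
    then show ?thesis by (simp add: N_def emeasure_distr)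
  qed
  interpret N: sigma_finite_measure N
  proof (unfold_locales, intro exI conjI ballI)
    show "countable (range (\<lambda>n. ball (0::'a) (real n)))" by simp
    show "range (\<lambda>n. ball (0::'a) (real n)) \<subseteq> sets N" by (auto simp: sN)
    have "\<exists>n. x \<in> ball 0 (real n)" for x :: 'a
      using reals_Archimedean2[of "norm x"] by auto
    then show "\<Union> (range (\<lambda>n. ball (0::'a) (real n))) = space N" by (auto simp: spN)
    fix a assume "a \<in> range (\<lambda>n. ball (0::'a) (real n))"
    then show "emeasure N a \<noteq> \<infinity>"
      using emeasure_lborel_ball_finite[of "0::'a"] by (auto simp: ball less_top[symmetric] simp del: emeasure_lborel_ball_finite)
  qed
  have tr: "distr N borel ((+) c) = N" for c
  proof -
    \<comment> \<open>Surjectivity of \<open>T\<close> lets a translation after \<open>T\<close> be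
      replaced by a translation before it.\<close>
    obtain c' where c': "T c' = c"
      using orthogonal_transformation_surj[OF T] by (metis surjD)
    have "distr N borel ((+) c) = distr lborel borel (\<lambda>x. c + T x)"
      unfolding N_def by (subst distr_distr) (auto simp: o_def)
    also have "\<dots> = distr lborel borel (T \<circ> (+) c')"
      using c' by (simp add: o_def linear_add[OF lin])
    also have "\<dots> = distr (distr lborel borel ((+) c')) borel T"
      by (subst distr_distr) auto
    finally show ?thesis by (simp add: N_def lborel_distr_plus)
  qed
  interpret P: pair_sigma_finite lborel N ..
  define A where "A = ball (0::'a) 1"
  have [measurable]: "A \<in> sets borel" by (simp add: A_def)
  have A_sym: "indicator A (x - y) = (indicator A (y - x) :: ennreal)" for x y
    by (simp add: A_def indicator_def norm_minus_commute)
  have "emeasure N S = emeasure lborel S" if S [measurable]: "S \<in> sets borel" for S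
  proof -
    \<comment> \<open>The two measures exchange roles: translate in \<open>y\<close> under
      \<open>N\<close>, then in \<open>x\<close> under \<open>lborel\<close>, then in
      \<open>y\<close> again, with Fubini between. The symmetry of the ball \<open>A\<close> brings
      the last integrand back to \<open>A\<close> itself, and the finite nonzero factor
      \<open>emeasure lborel A\<close> cancels.\<close>
    have "emeasure lborel A * emeasure N S = (\<integral>\<^sup>+x. \<integral>\<^sup>+y. indicator A x * indicator S y \<partial>N \<partial>lborel)"
      by (simp add: nn_integral_cmult nn_integral_multc sN)
    also have "\<dots> = (\<integral>\<^sup>+x. \<integral>\<^sup>+y. indicator A x * indicator S (x + y) \<partial>N \<partial>lborel)"
    proof (rule nn_integral_cong)
      fix x
      show "(\<integral>\<^sup>+y. indicator A x * indicator S y \<partial>N) = (\<integral>\<^sup>+y. indicator A x * indicator S (x + y) \<partial>N)"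
        by (rule nn_integral_translate[OF tr _ sN, symmetric]) measurable
    qed
    also have "\<dots> = (\<integral>\<^sup>+y. \<integral>\<^sup>+x. indicator A x * indicator S (x + y :: 'a) \<partial>lborel \<partial>N)"
      by (rule P.Fubini'[symmetric]) measurable
    also have "\<dots> = (\<integral>\<^sup>+y. \<integral>\<^sup>+x. indicator A (x - y) * indicator S x \<partial>lborel \<partial>N)"
    proof (rule nn_integral_cong)
      fix y :: 'a
      have "(\<integral>\<^sup>+x. indicator A (y + x - y) * indicator S (y + x) \<partial>lborel)
        = (\<integral>\<^sup>+x. indicator A (x - y) * indicator S x \<partial>lborel)"
        by (rule nn_integral_translate[OF lborel_distr_plus, of "\<lambda>x. indicator A (x - y) * indicator S x"]) auto
      then show "(\<integral>\<^sup>+x. indicator A x * indicator S (x + y :: 'a) \<partial>lborel)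
          = (\<integral>\<^sup>+x. indicator A (x - y) * indicator S x \<partial>lborel)"
        by (simp add: add.commute)
    qed
    also have "\<dots> = (\<integral>\<^sup>+x. \<integral>\<^sup>+y. indicator A (x - y) * indicator S x \<partial>N \<partial>lborel)"
      by (rule P.Fubini') measurable
    also have "\<dots> = (\<integral>\<^sup>+x. \<integral>\<^sup>+y. indicator A y * indicator S x \<partial>N \<partial>lborel)"
    proof (rule nn_integral_cong)
      fix x
      have "(\<integral>\<^sup>+y. indicator A (x + y - x) * indicator S x \<partial>N)
        = (\<integral>\<^sup>+y. indicator A (y - x) * indicator S x \<partial>N)"
        by (rule nn_integral_translate[OF tr _ sN, of "\<lambda>y. indicator A (y - x) * indicator S x"]) auto
      then show "(\<integral>\<^sup>+y. indicator A (x - y) * indicator S x \<partial>N) = (\<integral>\<^sup>+y. indicator A y * indicator S x \<partial>N)"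
        by (simp add: A_sym)
    qed
    also have "\<dots> = emeasure N A * emeasure lborel S"
      by (simp add: nn_integral_cmult nn_integral_multc sN)
    also have "emeasure N A = emeasure lborel A" unfolding A_def by (rule ball)
    finally have "emeasure lborel A * emeasure N S = emeasure lborel A * emeasure lborel S" .
    moreover have "emeasure lborel A \<noteq> 0" "emeasure lborel A \<noteq> top"
      using emeasure_lborel_ball_finite[of "0::'a" 1] content_ball_pos[of 1 "0::'a"]
      by (auto simp: A_def measure_def)
    ultimately show ?thesis by (simp add: ennreal_mult_cancel_left)
  qed
  then show ?thesis
    by (intro measure_eqI) (auto simp: N_def)
qed

text \<open>A unimodular complex scalar acts on the underlying real space as an orthogonal
  map.\<close>

lemma nn_integral_lborel_vector_scalar_mult:
  assumes c: "cmod c = 1" and f: "f \<in> borel_measurable borel"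
  shows "(\<integral>\<^sup>+v. f (c *s (v :: 'n::finite cvec)) \<partial>lborel) = (\<integral>\<^sup>+v. f v \<partial>lborel)"
proof -
  have lin: "linear (\<lambda>v::'n cvec. c *s v)"
    by (rule linearI) (auto simp: vec_eq_iff algebra_simps)
  have "orthogonal_transformation (\<lambda>v::'n cvec. c *s v)"
    using lin c by (simp add: orthogonal_transformation norm_vector_scalar_mult)
  note d = lborel_distr_orthogonal_transformation[OF this]
  have "(\<integral>\<^sup>+v. f v \<partial>lborel) = (\<integral>\<^sup>+v. f v \<partial>distr lborel borel (\<lambda>v::'n cvec. c *s v))"
    unfolding d ..
  also have "\<dots> = (\<integral>\<^sup>+v. f (c *s v) \<partial>lborel)"
    using lin f
    by (intro nn_integral_distr)
       (auto intro!: borel_measurable_continuous_onI linear_continuous_on linear_conv_bounded_linear[THEN iffD1])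
  finally show ?thesis by simp
qed

text \<open>Cauchy's formula is applied to the holomorphic square of \<open>f\<close> on the disc in
  direction \<open>v\<close>. The modulus of that square is the integrand, so no theory of
  subharmonic functions is involved.\<close>

lemma circle_mean_le:
  assumes f: "holo f D" and D: "\<And>s. cmod s \<le> 1 \<Longrightarrow> z + s *s v \<in> D"
  shows "ennreal ((cmod (f z))\<^sup>2) \<le>
    (\<integral>\<^sup>+t. indicator {0..1} t * ennreal ((cmod (f (z + exp (2 * of_real pi * \<i> * of_real t) *s v)))\<^sup>2) \<partial>lborel)"
proof -
  define \<phi> where "\<phi> s = (f (z + s *s v))\<^sup>2" for s
  define e where "e t = exp (2 * of_real pi * \<i> * complex_of_real t)" for t
  have e1: "cmod (e t) = 1" for t by (simp add: e_def)
  have "\<phi> holomorphic_on cball 0 1"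
    unfolding \<phi>_def using D by (intro holomorphic_intros holo_line_holomorphic[OF f]) auto
  from Cauchy_integral_circlepath_simple[OF this, of 0]
  have "((\<lambda>u. \<phi> u / u) has_contour_integral (2 * of_real pi * \<i> * \<phi> 0)) (circlepath 0 1)" by simp
  then have "((\<lambda>t. \<phi> (e t) / e t * (2 * of_real pi * \<i> * e t)) has_integral (2 * of_real pi * \<i> * \<phi> 0)) {0..1}"
    unfolding has_contour_integral_def e_def
    by (rule has_integral_eq[rotated]) (simp add: vector_derivative_circlepath01, simp add: circlepath)
  then have "((\<lambda>t. (2 * of_real pi * \<i>) * \<phi> (e t)) has_integral (2 * of_real pi * \<i>) * \<phi> 0) {0..1}"
    by (rule has_integral_eq[rotated]) (simp add: e_def)
  from has_integral_mult_right[OF this, of "inverse (2 * of_real pi * \<i>)"]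
  have int: "((\<lambda>t. \<phi> (e t)) has_integral \<phi> 0) {0..1}"
    by (simp add: field_simps)
  define g where "g t = (cmod (f (z + e t *s v)))\<^sup>2" for t
  have "continuous_on {0..1} (\<lambda>t. f (z + e t *s v))"
  proof (rule continuous_on_compose2[OF holo_imp_continuous_on[OF f]])
    show "continuous_on {0..1} (\<lambda>t. z + e t *s v)" unfolding e_def
      by (intro continuous_intros bounded_linear.continuous_on[OF bounded_linear_vector_scalar_mult_left])
  qed (use D e1 in auto)
  then have "continuous_on {0..1} g" unfolding g_def by (intro continuous_intros)
  then have gi: "(g has_integral integral {0..1} g) {0..1}"
    by (intro integrable_integral integrable_continuous_real)
  have "norm (integral {0..1} (\<lambda>t. \<phi> (e t))) \<le> integral {0..1} g"
    using int gi by (intro integral_norm_bound_integral) (auto simp: \<phi>_def g_def norm_power)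
  then have "(cmod (f z))\<^sup>2 \<le> integral {0..1} g"
    using integral_unique[OF int] by (simp add: \<phi>_def norm_power)
  then have "ennreal ((cmod (f z))\<^sup>2) \<le> ennreal (integral {0..1} g)" by (rule ennreal_leI)
  also have "\<dots> = (\<integral>\<^sup>+t. ennreal (indicator {0..1} t * g t) \<partial>lborel)"
    using nn_integral_has_integral_lebesgue[OF _ gi] by (simp add: g_def)
  also have "\<dots> = (\<integral>\<^sup>+t. indicator {0..1} t * ennreal (g t) \<partial>lborel)"
    by (intro nn_integral_cong) (auto simp: indicator_def)
  finally show ?thesis by (simp add: g_def e_def)
qed

lemma borel_measurable_indicator_sq_cmod:
  assumes "open D" "continuous_on D f"
  shows "(\<lambda>w. indicator D w * ennreal ((cmod (f w))\<^sup>2)) \<in> borel_measurable borel"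
proof -
  have "(\<lambda>w. indicator D w *\<^sub>R (cmod (f w))\<^sup>2) \<in> borel_measurable borel"
    using assms by (intro borel_measurable_continuous_on_indicator continuous_intros) auto
  then have "(\<lambda>w. ennreal (indicator D w *\<^sub>R (cmod (f w))\<^sup>2)) \<in> borel_measurable borel" by measurable
  also have "(\<lambda>w. ennreal (indicator D w *\<^sub>R (cmod (f w))\<^sup>2)) = (\<lambda>w. indicator D w * ennreal ((cmod (f w))\<^sup>2))"
    by (auto simp: indicator_def)
  finally show ?thesis .
qed

text \<open>The circle inequality is integrated over all directions \<open>v\<close> in the ball.
  After Fubini, rotation invariance makes the inner integral the same for every angle.\<close>

lemma ball_mean_le:
  fixes D :: "'n::finite cvec set"
  assumes f: "holo f D" and "open D" and r: "ball z r \<subseteq> D"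
  shows "emeasure lborel (ball (0::'n cvec) r) * ennreal ((cmod (f z))\<^sup>2)
    \<le> (\<integral>\<^sup>+w. indicator D w * ennreal ((cmod (f w))\<^sup>2) \<partial>lborel)"
proof -
  define F where "F w = indicator D w * ennreal ((cmod (f w))\<^sup>2)" for w
  define e where "e t = exp (2 * of_real pi * \<i> * complex_of_real t)" for t
  have e1: "cmod (e t) = 1" for t by (simp add: e_def)
  have [measurable]: "F \<in> borel_measurable borel"
    unfolding F_def by (rule borel_measurable_indicator_sq_cmod[OF \<open>open D\<close> holo_imp_continuous_on[OF f]])
  have [measurable]: "ball (0::'n cvec) r \<in> sets borel" by simp
  have "continuous_on UNIV (\<lambda>p. z + e (snd p) *s fst p)"
  proof -
    have "(\<lambda>p. z + e (snd p) *s fst p) = (\<lambda>p. z + (\<chi> i. e (snd p) * fst p $ i))"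
      by (simp add: vec_eq_iff fun_eq_iff)
    then show ?thesis unfolding e_def by (simp only:) (intro continuous_intros)
  qed
  then have "(\<lambda>p. z + e (snd p) *s fst p) \<in> borel_measurable (borel \<Otimes>\<^sub>M borel)"
    by (simp add: borel_prod borel_measurable_continuous_onI)
  from measurable_compose[OF this \<open>F \<in> borel_measurable borel\<close>]
  have meas: "(\<lambda>p. F (z + e (snd p) *s fst p)) \<in> borel_measurable (borel \<Otimes>\<^sub>M borel)" .
  have meas': "(\<lambda>p. indicator (ball 0 r) (fst p) * (indicator {0..1} (snd p) * F (z + e (snd p) *s fst p)))
      \<in> borel_measurable (borel \<Otimes>\<^sub>M borel)"
    by (intro borel_measurable_times_ennreal meas measurable_compose[OF measurable_fst borel_measurable_indicator]
      measurable_compose[OF measurable_snd borel_measurable_indicator]) auto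
  have "emeasure lborel (ball (0::'n cvec) r) * ennreal ((cmod (f z))\<^sup>2)
      = (\<integral>\<^sup>+v. indicator (ball (0::'n cvec) r) v * ennreal ((cmod (f z))\<^sup>2) \<partial>lborel)"
    by (subst nn_integral_multc, rule borel_measurable_indicator) simp_all
  also have "\<dots> \<le> (\<integral>\<^sup>+v. \<integral>\<^sup>+t. indicator (ball 0 r) v * (indicator {0..1} t * F (z + e t *s v)) \<partial>lborel \<partial>lborel)"
  proof (intro nn_integral_mono)
    fix v :: "'n cvec"
    show "indicator (ball 0 r) v * ennreal ((cmod (f z))\<^sup>2)
       \<le> (\<integral>\<^sup>+t. indicator (ball 0 r) v * (indicator {0..1} t * F (z + e t *s v)) \<partial>lborel)"
    proof (cases "v \<in> ball 0 r")
      case True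
      have D: "z + s *s v \<in> D" if "cmod s \<le> 1" for s
      proof -
        have "norm (s *s v) \<le> norm v"
          using that by (simp add: norm_vector_scalar_mult mult_left_le_one_le)
        then show ?thesis using True r by (auto simp: dist_norm subset_iff)
      qed
      then have "F (z + e t *s v) = ennreal ((cmod (f (z + e t *s v)))\<^sup>2)" for t
        by (simp add: F_def e1)
      with circle_mean_le[OF f D] True show ?thesis by (simp add: e_def)
    qed simp
  qed
  also have "\<dots> = (\<integral>\<^sup>+t. \<integral>\<^sup>+v. indicator (ball 0 r) v * (indicator {0..1} t * F (z + e t *s v)) \<partial>lborel \<partial>lborel)"
    using meas' by (intro lborel_pair.Fubini'[symmetric]) (simp add: case_prod_unfold)
  also have "\<dots> = (\<integral>\<^sup>+t. \<integral>\<^sup>+v. indicator (ball (0::'n cvec) r) v * (indicator {0..1} (t::real) * F (z + v)) \<partial>lborel \<partial>lborel)"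
  proof (rule nn_integral_cong)
    fix t :: real
    have "(\<integral>\<^sup>+v. indicator (ball 0 r) (e t *s v) * (indicator {0..1} t * F (z + e t *s v)) \<partial>lborel)
      = (\<integral>\<^sup>+v. indicator (ball 0 r) v * (indicator {0..1} t * F (z + v)) \<partial>lborel)"
      by (rule nn_integral_lborel_vector_scalar_mult[OF e1, of "\<lambda>v. indicator (ball 0 r) v * (indicator {0..1} t * F (z + v))"])
         measurable
    moreover have "indicator (ball 0 r) (e t *s v) = (indicator (ball 0 r) v :: ennreal)" for v :: "'n cvec"
      by (simp add: indicator_def norm_vector_scalar_mult e1)
    ultimately show "(\<integral>\<^sup>+v. indicator (ball 0 r) v * (indicator {0..1} t * F (z + e t *s v)) \<partial>lborel)
      = (\<integral>\<^sup>+v. indicator (ball (0::'n cvec) r) v * (indicator {0..1} t * F (z + v)) \<partial>lborel)" by simp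
  qed
  also have "\<dots> \<le> (\<integral>\<^sup>+t. \<integral>\<^sup>+v. indicator {0..1} (t::real) * F (z + v) \<partial>lborel \<partial>lborel)"
    by (intro nn_integral_mono) (auto simp: indicator_def)
  also have "\<dots> = (\<integral>\<^sup>+v. F (z + v) \<partial>lborel)"
    by (simp add: nn_integral_cmult nn_integral_multc)
  also have "\<dots> = (\<integral>\<^sup>+v. F v \<partial>lborel)"
    by (rule nn_integral_translate[OF lborel_distr_plus]) auto
  finally show ?thesis by (simp add: F_def)
qed

subsection \<open>The Bergman metric\<close>

definition Bergman_space :: "'n::finite cvec set \<Rightarrow> ('n cvec \<Rightarrow> complex) set" where
  "Bergman_space D = {f. holo f D \<and> set_integrable lborel D (\<lambda>w. (cmod (f w))\<^sup>2)}"

definition Bergman_inner :: "'n::finite cvec set \<Rightarrow> ('n cvec \<Rightarrow> complex) \<Rightarrow> ('n cvec \<Rightarrow> complex) \<Rightarrow> complex" where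
  "Bergman_inner D f g = (LINT w:D|lborel. f w * cnj (g w))"

lemma set_integrable_mult_cnj:
  assumes "f \<in> Bergman_space D" "g \<in> Bergman_space D" "open D"
  shows "set_integrable lborel D (\<lambda>w. f w * cnj (g w))"
proof (rule set_integrable_bound)
  show "set_integrable lborel D (\<lambda>w. (cmod (f w))\<^sup>2 + (cmod (g w))\<^sup>2)"
    using assms by (intro set_integral_add) (auto simp: Bergman_space_def)
  have "continuous_on D f" "continuous_on D g"
    using assms by (auto simp: Bergman_space_def holo_imp_continuous_on)
  then show "set_borel_measurable lborel D (\<lambda>w. f w * cnj (g w))"
    using assms(3) unfolding set_borel_measurable_def
    by (simp, intro borel_measurable_continuous_on_indicator continuous_intros) auto
  have "cmod (f w) * cmod (g w) \<le> (cmod (f w))\<^sup>2 + (cmod (g w))\<^sup>2" for w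
    using sum_squares_bound[of "cmod (f w)" "cmod (g w)"]
      mult_nonneg_nonneg[OF norm_ge_zero[of "f w"] norm_ge_zero[of "g w"]] by linarith
  then show "AE x in lborel. x \<in> D \<longrightarrow> norm (f x * cnj (g x)) \<le> norm ((cmod (f x))\<^sup>2 + (cmod (g x))\<^sup>2)"
    by (auto simp: norm_mult)
qed

lemma prehilbert_Bergman:
  assumes "open D"
  shows "prehilbert (Bergman_space D) (Bergman_inner D)"
proof
  have "(\<lambda>_. 0) \<in> Bergman_space D" by (simp add: Bergman_space_def holo_const set_integrable_def)
  then show "Bergman_space D \<noteq> {}" by blast
  fix f g h :: "'a cvec \<Rightarrow> complex" and a b :: complex
  assume f: "f \<in> Bergman_space D"
  show "0 \<le> Re (Bergman_inner D f f)"
  proof -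
    have "Bergman_inner D f f = (LINT w:D|lborel. complex_of_real ((cmod (f w))\<^sup>2))"
      unfolding Bergman_inner_def by (simp only: complex_norm_square)
    also have "\<dots> = of_real (LINT w:D|lborel. (cmod (f w))\<^sup>2)"
      by (rule set_integral_complex_of_real)
    also have "Re \<dots> = (LINT w:D|lborel. (cmod (f w))\<^sup>2)" by simp
    also have "0 \<le> \<dots>" unfolding set_lebesgue_integral_def by (intro Bochner_Integration.integral_nonneg) auto
    finally show ?thesis .
  qed
  assume g: "g \<in> Bergman_space D"
  show "Bergman_inner D g f = cnj (Bergman_inner D f g)"
  proof -
    have "cnj (Bergman_inner D f g) = (LINT w:D|lborel. cnj (f w * cnj (g w)))"
      unfolding Bergman_inner_def set_lebesgue_integral_def
      by (simp add: Bochner_Integration.integral_cnj[symmetric] del: Bochner_Integration.integral_cnj)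
    then show ?thesis by (simp add: Bergman_inner_def mult.commute)
  qed
  have hol: "holo (\<lambda>x. a * f x + b * g x) D"
    using f g by (intro holo_lincomb) (auto simp: Bergman_space_def)
  have "set_integrable lborel D (\<lambda>w. (cmod (a * f w + b * g w))\<^sup>2)"
  proof (rule set_integrable_bound)
    show "set_integrable lborel D (\<lambda>w. 2 * (cmod a)\<^sup>2 * (cmod (f w))\<^sup>2 + 2 * (cmod b)\<^sup>2 * (cmod (g w))\<^sup>2)"
      using f g by (intro set_integral_add set_integrable_mult_right) (auto simp: Bergman_space_def)
    show "set_borel_measurable lborel D (\<lambda>w. (cmod (a * f w + b * g w))\<^sup>2)"
      using \<open>open D\<close> f g holo_imp_continuous_on unfolding set_borel_measurable_def Bergman_space_def
      by (simp, intro borel_measurable_continuous_on_indicator[where 'b=real, simplified] continuous_intros) auto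
    have "(cmod (a * f w + b * g w))\<^sup>2 \<le> 2 * (cmod a)\<^sup>2 * (cmod (f w))\<^sup>2 + 2 * (cmod b)\<^sup>2 * (cmod (g w))\<^sup>2" for w
    proof -
      have "(cmod (a * f w + b * g w))\<^sup>2 \<le> (cmod (a * f w) + cmod (b * g w))\<^sup>2"
        by (intro power_mono norm_triangle_ineq) auto
      also have "\<dots> \<le> 2 * (cmod (a * f w))\<^sup>2 + 2 * (cmod (b * g w))\<^sup>2"
        using sum_squares_bound[of "cmod (a * f w)" "cmod (b * g w)"] by (simp add: power2_sum)
      finally show ?thesis by (simp add: norm_mult power_mult_distrib)
    qed
    then show "AE x in lborel. x \<in> D \<longrightarrow> norm ((cmod (a * f x + b * g x))\<^sup>2)
        \<le> norm (2 * (cmod a)\<^sup>2 * (cmod (f x))\<^sup>2 + 2 * (cmod b)\<^sup>2 * (cmod (g x))\<^sup>2)"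
      by simp
  qed
  with hol show "(\<lambda>x. a * f x + b * g x) \<in> Bergman_space D" by (simp add: Bergman_space_def)
  assume h: "h \<in> Bergman_space D"
  have "Bergman_inner D (\<lambda>x. a * f x + b * g x) h
      = (LINT w:D|lborel. a * (f w * cnj (h w)) + b * (g w * cnj (h w)))"
    unfolding Bergman_inner_def by (simp add: algebra_simps)
  also have "\<dots> = a * Bergman_inner D f h + b * Bergman_inner D g h"
    unfolding Bergman_inner_def
    using set_integrable_mult_cnj[OF f h \<open>open D\<close>] set_integrable_mult_cnj[OF g h \<open>open D\<close>]
    by (simp add: set_integral_add set_integrable_mult_right)
  finally show "Bergman_inner D (\<lambda>x. a * f x + b * g x) h = a * Bergman_inner D f h + b * Bergman_inner D g h" .
qed

text \<open>Circles of radius below \<open>r / 2\<close> about points of the half disc stay in the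
  disc; the radius then tends to \<open>r / 2\<close>. Uniformity in \<open>s\<close> is what later
  makes bounds in the dual norm uniform along a line.\<close>

lemma higher_deriv_bound_half:
  assumes hol: "\<phi> holomorphic_on ball 0 r" and b: "\<And>s. s \<in> ball 0 r \<Longrightarrow> cmod (\<phi> s) \<le> M"
    and s: "s \<in> ball 0 (r / 2)"
  shows "cmod ((deriv ^^ n) \<phi> s) \<le> fact n * M / (r / 2) ^ n"
proof -
  have r: "0 < r" using s by (metis ball_eq_empty empty_iff half_gt_zero_iff linorder_not_le)
  have sub: "x \<in> ball 0 r" if "cmod (s - x) < r / 2" for x
    using that s norm_triangle_sub[of x s] by (simp add: norm_minus_commute)
  have bd: "cmod ((deriv ^^ n) \<phi> s) \<le> fact n * M / t ^ n" if t: "0 < t" "t < r / 2" for t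
  proof (rule Cauchy_inequality)
    show "continuous_on (cball s t) \<phi>"
      using sub t by (intro continuous_on_subset[OF holomorphic_on_imp_continuous_on[OF hol]]) (auto simp: dist_norm)
    show "\<phi> holomorphic_on ball s t"
      using sub t by (intro holomorphic_on_subset[OF hol]) (auto simp: dist_norm)
    show "cmod (\<phi> x) \<le> M" if "cmod (s - x) = t" for x
      using that sub t by (intro b) auto
  qed (use t in auto)
  show ?thesis
  proof (rule tendsto_lowerbound)
    show "((\<lambda>t. fact n * M / t ^ n) \<longlongrightarrow> fact n * M / (r / 2) ^ n) (at_left (r / 2))"
      using r by (intro tendsto_intros) auto
    show "\<forall>\<^sub>F t in at_left (r / 2). cmod ((deriv ^^ n) \<phi> s) \<le> fact n * M / t ^ n"
      using bd r by (auto simp: eventually_at_left[of 0 "r/2"] intro!: exI[of _ 0])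
  qed auto
qed

section \<open>Evaluation functionals and the Bergman kernel on the diagonal\<close>

locale bounded_open_set =
  fixes D :: "'n::finite cvec set"
  assumes open_D: "open D" and bounded_D: "bounded D"
begin

sublocale prehilbert "Bergman_space D" "Bergman_inner D"
  by (rule prehilbert_Bergman[OF open_D])

abbreviation "A2 \<equiv> Bergman_space D"

lemma Bergman_holo: "f \<in> A2 \<Longrightarrow> holo f D"
  by (simp add: Bergman_space_def)

lemma nrm_sq: "f \<in> A2 \<Longrightarrow> (nrm f)\<^sup>2 = (LINT w:D|lborel. (cmod (f w))\<^sup>2)"
proof -
  assume f: "f \<in> A2"
  have "of_real ((nrm f)\<^sup>2) = (LINT w:D|lborel. complex_of_real ((cmod (f w))\<^sup>2))"
    unfolding ip_self[OF f, symmetric] Bergman_inner_def by (simp only: complex_norm_square)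
  also have "\<dots> = of_real (LINT w:D|lborel. (cmod (f w))\<^sup>2)"
    by (rule set_integral_complex_of_real)
  finally show ?thesis by (simp only: of_real_eq_iff)
qed

lemma nn_integral_sq:
  assumes f: "f \<in> A2"
  shows "(\<integral>\<^sup>+w. indicator D w * ennreal ((cmod (f w))\<^sup>2) \<partial>lborel) = ennreal ((nrm f)\<^sup>2)"
proof -
  have "(\<integral>\<^sup>+w. indicator D w * ennreal ((cmod (f w))\<^sup>2) \<partial>lborel)
      = (\<integral>\<^sup>+w. ennreal (indicator D w *\<^sub>R (cmod (f w))\<^sup>2) \<partial>lborel)"
    by (intro nn_integral_cong) (auto simp: indicator_def)
  also have "\<dots> = ennreal (\<integral>w. indicator D w *\<^sub>R (cmod (f w))\<^sup>2 \<partial>lborel)"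
    using f by (intro nn_integral_eq_integral) (auto simp: Bergman_space_def set_integrable_def)
  also have "\<dots> = ennreal ((nrm f)\<^sup>2)"
    using nrm_sq[OF f] by (simp add: set_lebesgue_integral_def)
  finally show ?thesis .
qed

text \<open>Identifies the competitors in \<open>bergman_diag\<close> with the unit ball of the
  Bergman space, so that \<open>dual_norm_Sup\<close> applies.\<close>

lemma unit_ball_iff:
  "holo f D \<and> (\<integral>\<^sup>+w. indicator D w * ennreal ((cmod (f w))\<^sup>2) \<partial>lborel) \<le> 1 \<longleftrightarrow> f \<in> A2 \<and> nrm f \<le> 1"
  (is "?l \<longleftrightarrow> ?r")
proof
  assume l: ?l
  have "integrable lborel (\<lambda>w. indicator D w *\<^sub>R (cmod (f w))\<^sup>2)"
  proof (rule integrableI_nonneg)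
    show "(\<lambda>w. indicator D w *\<^sub>R (cmod (f w))\<^sup>2) \<in> borel_measurable lborel"
      using l open_D holo_imp_continuous_on[of f D]
      by (simp, intro borel_measurable_continuous_on_indicator[where 'b=real, simplified] continuous_intros) auto
    have "(\<integral>\<^sup>+w. ennreal (indicator D w *\<^sub>R (cmod (f w))\<^sup>2) \<partial>lborel)
        = (\<integral>\<^sup>+w. indicator D w * ennreal ((cmod (f w))\<^sup>2) \<partial>lborel)"
      by (intro nn_integral_cong) (auto simp: indicator_def)
    also have "\<dots> \<le> 1" using l by simp
    also have "\<dots> < \<infinity>" by simp
    finally show "(\<integral>\<^sup>+w. ennreal (indicator D w *\<^sub>R (cmod (f w))\<^sup>2) \<partial>lborel) < \<infinity>" .
  qed simp
  then have f: "f \<in> A2" using l by (simp add: Bergman_space_def set_integrable_def)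
  then have "ennreal ((nrm f)\<^sup>2) \<le> 1" using l nn_integral_sq by simp
  then have "nrm f \<le> 1" using nrm_nonneg[OF f] by (simp add: abs_square_le_1[of "nrm f"])
  with f show ?r by simp
next
  assume r: ?r
  then have "(nrm f)\<^sup>2 \<le> 1" using nrm_nonneg[of f] by (simp add: abs_square_le_1)
  with r show ?l using nn_integral_sq[of f] Bergman_holo[of f] by simp
qed

text \<open>The mean value inequality bounds the evaluation at the centre of a ball in
  \<open>D\<close> by the inverse root of the volume of that ball.\<close>

definition ball_const :: "real \<Rightarrow> real" where
  "ball_const r = 1 / sqrt (measure lborel (ball (0::'n cvec) r))"

lemma ball_const_nonneg: "0 \<le> ball_const r"
  by (simp add: ball_const_def)

lemma bnd_eval:
  assumes "0 < r" "ball z r \<subseteq> D"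
  shows "bnd (ball_const r) (\<lambda>f. f z)"
  unfolding bnd_def
proof (intro conjI ballI ball_const_nonneg)
  fix f assume f: "f \<in> A2"
  define m where "m = measure lborel (ball (0::'n cvec) r)"
  have m: "0 < m" using assms(1) content_ball_pos[of r "0::'n cvec"] by (simp add: m_def)
  have "ennreal m * ennreal ((cmod (f z))\<^sup>2) \<le> ennreal ((nrm f)\<^sup>2)"
    using ball_mean_le[OF Bergman_holo[OF f] open_D assms(2)] nn_integral_sq[OF f]
      emeasure_eq_ennreal_measure[of lborel "ball (0::'n cvec) r"] emeasure_lborel_ball_finite[of "0::'n cvec" r]
    by (simp add: m_def less_top del: emeasure_lborel_ball_finite)
  then have "m * (cmod (f z))\<^sup>2 \<le> (nrm f)\<^sup>2"
    using m by (simp add: ennreal_mult'[symmetric])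
  then have "(sqrt m * cmod (f z))\<^sup>2 \<le> (nrm f)\<^sup>2"
    using m by (simp add: power_mult_distrib)
  then have "sqrt m * cmod (f z) \<le> nrm f"
    using nrm_nonneg[OF f] power2_le_imp_le by blast
  then show "cmod (f z) \<le> ball_const r * nrm f"
    using m by (simp add: ball_const_def m_def[symmetric] field_simps)
qed

lemma ex_ball: "z \<in> D \<Longrightarrow> \<exists>r>0. ball z r \<subseteq> D"
  using open_D open_contains_ball by blast

lemma eval_in_dual: "z \<in> D \<Longrightarrow> (\<lambda>f. f z) \<in> dual"
  using ex_ball[of z] bnd_eval[of _ z] by (auto simp: dual_def lin_def)

lemma bergman_diag_eq: "z \<in> D \<Longrightarrow> bergman_diag D z = Re (B (\<lambda>f. f z) (\<lambda>f. f z))"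
  unfolding bergman_diag_def unit_ball_iff by (rule dual_norm_Sup[OF eval_in_dual])

lemma emeasure_D_finite: "emeasure lborel D < \<infinity>"
  using emeasure_bounded_finite[OF bounded_D] .

lemma bounded_holo_in_Bergman:
  assumes "holo f D" "\<And>w. w \<in> D \<Longrightarrow> cmod (f w) \<le> C"
  shows "f \<in> A2" "(nrm f)\<^sup>2 \<le> C\<^sup>2 * measure lborel D"
proof -
  have C: "set_integrable lborel D (\<lambda>w. C\<^sup>2)"
    using emeasure_D_finite open_D unfolding set_integrable_def by (simp add: less_top)
  have le: "(cmod (f w))\<^sup>2 \<le> C\<^sup>2" if "w \<in> D" for w
    using assms(2)[OF that] by (intro power_mono) auto
  have int: "set_integrable lborel D (\<lambda>w. (cmod (f w))\<^sup>2)"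
  proof (rule set_integrable_bound[OF C])
    show "set_borel_measurable lborel D (\<lambda>w. (cmod (f w))\<^sup>2)"
      using open_D holo_imp_continuous_on[OF assms(1)] unfolding set_borel_measurable_def
      by (simp, intro borel_measurable_continuous_on_indicator[where 'b=real, simplified] continuous_intros) auto
  qed (use le in auto)
  with assms(1) show f: "f \<in> A2" by (simp add: Bergman_space_def)
  have "(nrm f)\<^sup>2 \<le> (LINT w:D|lborel. C\<^sup>2)"
    unfolding nrm_sq[OF f] by (rule set_integral_mono[OF int C le])
  also have "\<dots> = C\<^sup>2 * measure lborel D"
    using emeasure_D_finite open_D by (simp add: set_lebesgue_integral_def less_top)
  finally show "(nrm f)\<^sup>2 \<le> C\<^sup>2 * measure lborel D" .
qed

text \<open>The constant 1 is a test function because \<open>D\<close> has finite volume. This keeps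
  the argument of \<open>ln\<close> positive and later bounds \<open>1 / K\<close> by the
  volume.\<close>

lemma bergman_diag_lower:
  assumes z: "z \<in> D"
  shows "1 \<le> bergman_diag D z * measure lborel D"
proof -
  have one: "(\<lambda>_. 1) \<in> A2" "(nrm (\<lambda>_. 1))\<^sup>2 \<le> measure lborel D"
    using bounded_holo_in_Bergman[of "\<lambda>_. 1" 1] by (auto simp: holo_const)
  have "1 \<le> bergman_diag D z * (nrm (\<lambda>_. 1))\<^sup>2"
    using dual_norm_bound[OF eval_in_dual[OF z] one(1)] by (simp add: bergman_diag_eq[OF z])
  also have "\<dots> \<le> bergman_diag D z * measure lborel D"
    using one(2) B_self_nonneg[OF eval_in_dual[OF z]]
    by (intro mult_left_mono) (auto simp: bergman_diag_eq[OF z])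
  finally show ?thesis .
qed

lemma bergman_diag_pos:
  assumes z: "z \<in> D"
  shows "0 < bergman_diag D z"
  using bergman_diag_lower[OF z] B_self_nonneg[OF eval_in_dual[OF z]] bergman_diag_eq[OF z]
  by (cases "bergman_diag D z = 0") auto

section \<open>Evaluations along a complex line as a curve in the dual\<close>

definition line_deriv :: "'n cvec \<Rightarrow> 'n cvec \<Rightarrow> nat \<Rightarrow> complex \<Rightarrow> ('n cvec \<Rightarrow> complex) \<Rightarrow> complex" where
  "line_deriv z u n t = (\<lambda>f. (deriv ^^ n) (\<lambda>s. f (z + s *s u)) t)"

text \<open>A single \<open>r\<close> for all \<open>s\<close> gives the evaluations along the disc
  a common norm bound.\<close>

definition good_radius :: "'n cvec \<Rightarrow> 'n cvec \<Rightarrow> real \<Rightarrow> bool" where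
  "good_radius z u \<rho> \<longleftrightarrow> 0 < \<rho> \<and> (\<exists>r>0. \<forall>s\<in>ball 0 \<rho>. ball (z + s *s u) r \<subseteq> D)"

lemma good_radiusI:
  assumes "0 < r" "ball z r \<subseteq> D" "0 < \<rho>" "\<rho> * norm u \<le> r / 2" "s \<in> ball 0 \<rho>"
  shows "ball (z + s *s u) (r / 2) \<subseteq> D"
proof
  fix w assume w: "w \<in> ball (z + s *s u) (r / 2)"
  have "dist z w \<le> dist z (z + s *s u) + dist (z + s *s u) w" by (rule dist_triangle)
  also have "dist z (z + s *s u) \<le> \<rho> * norm u"
    using assms(5) by (simp add: dist_norm norm_vector_scalar_mult mult_right_mono)
  finally show "w \<in> D" using w assms(2,4) by auto
qed

lemma ex_good_radius:
  assumes "z \<in> D" shows "\<exists>\<rho>. good_radius z u \<rho>"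
proof -
  obtain r where r: "0 < r" "ball z r \<subseteq> D" using ex_ball[OF assms] by blast
  \<comment> \<open>Adding 1 to the norm covers \<open>u = 0\<close>.\<close>
  define \<rho> where "\<rho> = r / 2 / (norm u + 1)"
  have n1: "0 < norm u + 1" using norm_ge_zero[of u] by linarith
  have \<rho>: "0 < \<rho>" using r n1 by (simp add: \<rho>_def)
  have "\<rho> * norm u \<le> \<rho> * (norm u + 1)" using \<rho> by (intro mult_left_mono) auto
  also have "\<dots> = r / 2"
    using n1 by (intro iffD1[OF nonzero_eq_divide_eq \<rho>_def]) simp
  finally have "good_radius z u \<rho>"
    unfolding good_radius_def using \<rho> r good_radiusI[OF r \<rho>] by (intro conjI exI[of _ "r/2"]) auto
  then show ?thesis by blast
qed

lemma good_radius_in_D: "good_radius z u \<rho> \<Longrightarrow> s \<in> ball 0 \<rho> \<Longrightarrow> z + s *s u \<in> D"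
  unfolding good_radius_def by (metis centre_in_ball subset_iff)

lemma line_holomorphic:
  assumes "good_radius z u \<rho>" "f \<in> A2"
  shows "(\<lambda>s. f (z + s *s u)) holomorphic_on ball 0 \<rho>"
  using good_radius_in_D[OF assms(1)] by (intro holo_line_holomorphic[OF Bergman_holo[OF assms(2)]])

text \<open>Cauchy's estimate turns the common bound on evaluations into a bound for each derivative
  that is proportional to \<open>nrm f\<close>, hence into a bound in the dual norm.\<close>

lemma line_deriv_bnd:
  assumes g: "good_radius z u \<rho>"
  shows "\<exists>C\<ge>0. \<forall>t\<in>ball 0 (\<rho> / 2). bnd C (line_deriv z u n t)"
proof -
  obtain r where r: "0 < r" "\<And>s. s \<in> ball 0 \<rho> \<Longrightarrow> ball (z + s *s u) r \<subseteq> D" and \<rho>: "0 < \<rho>"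
    using g by (auto simp: good_radius_def)
  define C where "C = fact n * ball_const r / (\<rho> / 2) ^ n"
  have C: "0 \<le> C" using \<rho> by (simp add: C_def ball_const_nonneg)
  have "bnd C (line_deriv z u n t)" if t: "t \<in> ball 0 (\<rho> / 2)" for t
    unfolding bnd_def
  proof (intro conjI ballI C)
    fix f assume f: "f \<in> A2"
    have "cmod (line_deriv z u n t f) \<le> fact n * (ball_const r * nrm f) / (\<rho> / 2) ^ n"
      unfolding line_deriv_def
      by (rule higher_deriv_bound_half[OF line_holomorphic[OF g f] bnd_apply[OF bnd_eval[OF r] f] t])
    then show "cmod (line_deriv z u n t f) \<le> C * nrm f" by (simp add: C_def)
  qed
  with C show ?thesis by blast
qed

lemma line_deriv_dual:
  assumes g: "good_radius z u \<rho>" and t: "t \<in> ball 0 (\<rho> / 2)"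
  shows "line_deriv z u n t \<in> dual"
proof -
  have \<rho>: "0 < \<rho>" using g by (simp add: good_radius_def)
  have t': "t \<in> ball 0 \<rho>" using t \<rho> by auto
  have "lin (line_deriv z u n t)"
    unfolding lin_def
  proof (intro ballI allI)
    fix f h a b assume f: "f \<in> A2" and h: "h \<in> A2"
    note hf = line_holomorphic[OF g f] and hh = line_holomorphic[OF g h]
    show "line_deriv z u n t (\<lambda>x. a * f x + b * h x) = a * line_deriv z u n t f + b * line_deriv z u n t h"
      unfolding line_deriv_def
      by (subst higher_deriv_add[OF holomorphic_on_mult[OF holomorphic_on_const hf]
              holomorphic_on_mult[OF holomorphic_on_const hh] open_ball t'])
         (simp add: higher_deriv_cmult[OF hf t' open_ball] higher_deriv_cmult[OF hh t' open_ball])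
  qed
  then show ?thesis using line_deriv_bnd[OF g, of n] t by (auto simp: dual_def)
qed

text \<open>First-order Taylor expansion, whose remainder is controlled by derivative
  \<open>n + 2\<close> uniformly over the unit ball. With \<open>t\<close> and \<open>h\<close>
  below a quarter of the radius, \<open>t + h\<close> stays in the half disc where the bound
  holds.\<close>

lemma line_dual_deriv:
  assumes g: "good_radius z u \<rho>" and t: "\<bar>t\<bar> < \<rho> / 4"
  shows "dual_deriv (\<lambda>t. line_deriv z u n (of_real t)) (line_deriv z u (Suc n) (of_real t)) t"
proof -
  have \<rho>: "0 < \<rho>" using g by (simp add: good_radius_def)
  obtain C where C: "0 \<le> C" "\<And>t. t \<in> ball 0 (\<rho> / 2) \<Longrightarrow> bnd C (line_deriv z u (Suc (Suc n)) t)"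
    using line_deriv_bnd[OF g] by blast
  show ?thesis
    unfolding dual_deriv_def
  proof (rule exI[of _ C], rule exI[of _ "\<rho> / 4"], intro conjI allI impI)
    fix h :: real assume h: "\<bar>h\<bar> < \<rho> / 4"
    have t2: "of_real t \<in> ball (0::complex) (\<rho> / 2)" using t \<rho> by simp
    have th: "of_real (t + h) \<in> ball (0::complex) (\<rho> / 2)"
      using t h \<rho> abs_triangle_ineq[of t h] by (simp del: of_real_add)
    show "line_deriv z u n (of_real (t + h)) \<in> dual" by (rule line_deriv_dual[OF g th])
    show "bnd (C * h\<^sup>2) (\<lambda>f. line_deriv z u n (of_real (t + h)) f
        - (line_deriv z u n (of_real t) f + of_real h * line_deriv z u (Suc n) (of_real t) f))"
      unfolding bnd_def
    proof (intro conjI ballI)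
      show "0 \<le> C * h\<^sup>2" using C by simp
      fix f assume f: "f \<in> A2"
      define \<phi> where "\<phi> = (\<lambda>s. f (z + s *s u))"
      have hol: "\<phi> holomorphic_on ball 0 \<rho>" unfolding \<phi>_def by (rule line_holomorphic[OF g f])
      have "cmod ((deriv ^^ (n + 0)) \<phi> (of_real (t + h)) - (\<Sum>i\<le>1. (deriv ^^ (n + i)) \<phi> (of_real t) * (of_real (t + h) - of_real t) ^ i / fact i))
        \<le> C * nrm f * cmod (of_real (t + h) - of_real t) ^ Suc 1 / fact 1"
      proof (rule complex_Taylor[where S="ball 0 (\<rho> / 2)" and f="\<lambda>i. (deriv ^^ (n + i)) \<phi>"])
        fix i and x :: complex assume x: "x \<in> ball 0 (\<rho> / 2)"
        show "((deriv ^^ (n + i)) \<phi> has_field_derivative (deriv ^^ (n + Suc i)) \<phi> x) (at x within ball 0 (\<rho> / 2))"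
          using has_field_derivative_higher_deriv[OF hol open_ball, of x "n + i"] x \<rho>
          by (auto intro: has_field_derivative_at_within)
      next
        fix x :: complex assume x: "x \<in> ball 0 (\<rho> / 2)"
        show "cmod ((deriv ^^ (n + Suc 1)) \<phi> x) \<le> C * nrm f"
          using bnd_apply[OF C(2)[OF x] f] by (simp add: line_deriv_def \<phi>_def)
      qed (use t2 th in auto)
      then show "cmod (line_deriv z u n (of_real (t + h)) f
        - (line_deriv z u n (of_real t) f + of_real h * line_deriv z u (Suc n) (of_real t) f)) \<le> C * h\<^sup>2 * nrm f"
        by (simp add: line_deriv_def \<phi>_def[symmetric] power2_eq_square algebra_simps)
    qed
  qed (use \<rho> in auto)
qed

text \<open>With F the squared norm of the curve, the product rule gives F' and F'', and the formula
  is (ln F)'' = F''/F - (F'/F)^2.\<close>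

lemma ln_bergman_diag_second_deriv:
  assumes g: "good_radius z u \<rho>"
  defines "X \<equiv> \<lambda>n. line_deriv z u n 0"
  shows "deriv (deriv (\<lambda>t::real. ln (bergman_diag D (z + t *\<^sub>R u)))) 0
    = 2 * (Re (B (X 2) (X 0)) + Re (B (X 1) (X 1))) / bergman_diag D z
      - (2 * Re (B (X 1) (X 0)))\<^sup>2 / (bergman_diag D z)\<^sup>2"
proof -
  have \<rho>: "0 < \<rho>" using g by (simp add: good_radius_def)
  define Y where "Y n t = line_deriv z u n (complex_of_real t)" for n t
  define F where "F t = bergman_diag D (z + t *\<^sub>R u)" for t :: real
  define G where "G t = 2 * Re (B (Y 1 t) (Y 0 t))" for t
  have scale: "t *\<^sub>R u = complex_of_real t *s u" for t
    by (simp add: vec_eq_iff) (simp add: scaleR_conv_of_real)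
  have inD: "z + t *\<^sub>R u \<in> D" if "\<bar>t\<bar> < \<rho>" for t
    using good_radius_in_D[OF g, of "of_real t"] that by (simp add: scale)
  have Yd: "Y n t \<in> dual" if "\<bar>t\<bar> < \<rho> / 4" for n t
    unfolding Y_def using that \<rho> by (intro line_deriv_dual[OF g]) auto
  have F: "F t = Re (B (Y 0 t) (Y 0 t))" if "\<bar>t\<bar> < \<rho> / 4" for t
    using bergman_diag_eq[OF inD, of t] that \<rho> by (simp add: F_def Y_def line_deriv_def scale)
  have Fpos: "0 < F t" if "\<bar>t\<bar> < \<rho> / 4" for t
    unfolding F_def using that \<rho> by (intro bergman_diag_pos inD) auto
  have dY: "((\<lambda>s. B (Y m s) (Y n s)) has_vector_derivative B (Y (Suc m) t) (Y n t) + B (Y m t) (Y (Suc n) t)) (at t)"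
    if t: "\<bar>t\<bar> < \<rho> / 4" for m n t
    unfolding Y_def
    by (rule B_has_vector_derivative[OF line_dual_deriv[OF g t] line_dual_deriv[OF g t]
          Yd[OF t, unfolded Y_def] Yd[OF t, unfolded Y_def]])
  have dRe: "((\<lambda>s. Re (B (Y m s) (Y n s))) has_field_derivative
      Re (B (Y (Suc m) t) (Y n t)) + Re (B (Y m t) (Y (Suc n) t))) (at t)"
    if t: "\<bar>t\<bar> < \<rho> / 4" for m n t
    using bounded_linear.has_vector_derivative[OF bounded_linear_Re dY[OF t, of m n]] by (simp add: has_real_derivative_iff_has_vector_derivative)
  have opn: "open {t. \<bar>t\<bar> < \<rho> / 4}"
    by (intro open_Collect_less continuous_intros)
  have dF: "(F has_field_derivative G t) (at t)" if t: "\<bar>t\<bar> < \<rho> / 4" for t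
  proof (rule has_field_derivative_transform_within_open[OF _ opn])
    have "Re (B (Y 0 t) (Y 1 t)) = Re (B (Y 1 t) (Y 0 t))"
      using B_cnj[OF Yd[OF t] Yd[OF t], of 0 1] by simp
    then show "((\<lambda>s. Re (B (Y 0 s) (Y 0 s))) has_field_derivative G t) (at t)"
      using dRe[OF t, of 0 0] by (simp add: G_def)
  qed (use t F in auto)
  have dlnF: "deriv (\<lambda>t. ln (F t)) t = G t / F t" if t: "\<bar>t\<bar> < \<rho> / 4" for t
    using Fpos[OF t] by (auto intro!: DERIV_imp_deriv derivative_eq_intros dF[OF t])
  \<comment> \<open>The outer \<open>deriv\<close> needs the formula for the first derivative in a
    neighbourhood of 0, not only at 0.\<close>
  have "\<forall>\<^sub>F t in nhds 0. \<bar>t\<bar> < \<rho> / 4"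
    using eventually_nhds_in_open[OF opn, of 0] \<rho> by simp
  then have "\<forall>\<^sub>F t in nhds 0. deriv (\<lambda>t. ln (F t)) t = G t / F t"
    by (rule eventually_mono) (rule dlnF)
  then have "deriv (deriv (\<lambda>t. ln (F t))) 0 = deriv (\<lambda>t. G t / F t) 0"
    by (rule deriv_cong_ev) simp
  also have "\<dots> = 2 * (Re (B (Y 2 0) (Y 0 0)) + Re (B (Y 1 0) (Y 1 0))) / F 0 - (G 0)\<^sup>2 / (F 0)\<^sup>2"
  proof (rule DERIV_imp_deriv)
    have z0: "\<bar>0::real\<bar> < \<rho> / 4" using \<rho> by simp
    have "(G has_field_derivative 2 * (Re (B (Y 2 0) (Y 0 0)) + Re (B (Y 1 0) (Y 1 0)))) (at 0)"
      using dRe[OF z0, of 1 0] unfolding G_def numeral_2_eq_2 One_nat_def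
      by (intro DERIV_cmult)
    note dG = this
    show "((\<lambda>t. G t / F t) has_field_derivative
        2 * (Re (B (Y 2 0) (Y 0 0)) + Re (B (Y 1 0) (Y 1 0))) / F 0 - (G 0)\<^sup>2 / (F 0)\<^sup>2) (at 0)"
      by (rule DERIV_cong[OF DERIV_divide[OF dG dF[OF z0]]])
         (use Fpos[OF z0] in \<open>simp_all add: diff_divide_distrib power2_eq_square\<close>)
  qed
  finally show ?thesis by (simp add: F_def G_def Y_def X_def)
qed

lemma line_deriv_grad_app:
  assumes "z \<in> D" "f \<in> A2"
  shows "line_deriv z u 1 0 f = grad_app f z u"
  using holo_line_has_field_derivative[OF Bergman_holo[OF assms(2)], of z 0 u] assms(1)
  by (simp add: line_deriv_def DERIV_imp_deriv)

lemma line_deriv_ii: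
  assumes z: "z \<in> D" and f: "f \<in> A2"
  shows "line_deriv z (\<i> *s u) n 0 f = \<i> ^ n * line_deriv z u n 0 f"
proof -
  obtain \<rho> where \<rho>: "good_radius z u \<rho>" using ex_good_radius[OF z] by blast
  have "(deriv ^^ n) (\<lambda>w. (\<lambda>s. f (z + s *s u)) (\<i> * w + 0)) 0 = \<i> ^ n * (deriv ^^ n) (\<lambda>s. f (z + s *s u)) (\<i> * 0 + 0)"
    by (rule higher_deriv_compose_linear'[OF line_holomorphic[OF \<rho> f] open_ball[of 0 \<rho>] open_ball[of 0 \<rho>]])
       (use \<rho> in \<open>auto simp: norm_mult good_radius_def\<close>)
  then show ?thesis by (simp add: line_deriv_def mult.commute[of "\<i>"])
qed

lemma grad_in_dual:
  assumes "z \<in> D" shows "(\<lambda>f. grad_app f z u) \<in> dual"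
proof -
  obtain \<rho> where \<rho>: "good_radius z u \<rho>" using ex_good_radius[OF assms] by blast
  then have "line_deriv z u 1 0 \<in> dual" by (intro line_deriv_dual) (auto simp: good_radius_def)
  moreover have "bnd C (\<lambda>f. grad_app f z u) = bnd C (line_deriv z u 1 0)" for C
    using line_deriv_grad_app[OF assms] by (auto simp: bnd_def)
  moreover have "lin (\<lambda>f. grad_app f z u)"
    unfolding lin_def
    by (intro ballI allI grad_app_lincomb[OF Bergman_holo Bergman_holo assms])
  ultimately show ?thesis by (simp add: dual_def)
qed

text \<open>In the sum of the two second derivatives of \<open>ln K\<close> the terms with the second complex derivative
  cancel, as \<open>\<i>\<^sup>2 = -1\<close>.\<close>

lemma bergman_metric_eq:
  fixes u
  assumes z: "z \<in> D"
  defines "a \<equiv> \<lambda>f. f z" and "b \<equiv> \<lambda>f. grad_app f z u"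
  shows "bergman_metric D z u = Re (B b b) / bergman_diag D z - (cmod (B b a))\<^sup>2 / (bergman_diag D z)\<^sup>2"
proof -
  obtain \<rho> where \<rho>: "good_radius z u \<rho>" using ex_good_radius[OF z] by blast
  obtain \<rho>' where \<rho>': "good_radius z (\<i> *s u) \<rho>'" using ex_good_radius[OF z] by blast
  have a: "a \<in> dual" and b: "b \<in> dual"
    unfolding a_def b_def by (rule eval_in_dual[OF z], rule grad_in_dual[OF z])
  have c: "line_deriv z u 2 0 \<in> dual" using \<rho> by (intro line_deriv_dual) (auto simp: good_radius_def)
  have d: "line_deriv z v n 0 \<in> dual" for v n
    using ex_good_radius[OF z, of v] line_deriv_dual[of z v _ 0 n] by (auto simp: good_radius_def)
  have x0: "line_deriv z v 0 0 = a" for v by (simp add: line_deriv_def a_def)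
  have b1: "B (line_deriv z u 1 0) a = B b a"
    by (rule B_cong[OF a]) (simp_all add: b_def line_deriv_grad_app[OF z] del: One_nat_def)
  have b2: "B (line_deriv z u 1 0) (line_deriv z u 1 0) = B b b"
    by (rule B_cong[OF d]) (simp_all add: b_def line_deriv_grad_app[OF z] del: One_nat_def)
  \<comment> \<open>The zero summand brings the functional into the form required by
    \<open>dual_lincomb\<close> and \<open>B_lin_left\<close>.\<close>
  have ib: "line_deriv z (\<i> *s u) 1 0 f = \<i> * b f + 0 * b f" if "f \<in> A2" for f
    using line_deriv_ii[OF z that, of u 1] line_deriv_grad_app[OF z that, of u] by (simp add: b_def)
  have b3: "B (line_deriv z (\<i> *s u) 1 0) a = \<i> * B b a"
  proof -
    have "B (line_deriv z (\<i> *s u) 1 0) a = B (\<lambda>f. \<i> * b f + 0 * b f) a"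
      by (rule B_cong[OF a]) (simp_all only: ib)
    then show ?thesis by (simp only: B_lin_left[OF b b a]) simp
  qed
  have ibd: "(\<lambda>f. \<i> * b f + 0 * b f) \<in> dual" by (rule dual_lincomb[OF b b])
  have b4: "B (line_deriv z (\<i> *s u) 1 0) (line_deriv z (\<i> *s u) 1 0) = B b b"
  proof -
    have "B (line_deriv z (\<i> *s u) 1 0) (line_deriv z (\<i> *s u) 1 0) = B (\<lambda>f. \<i> * b f + 0 * b f) (\<lambda>f. \<i> * b f + 0 * b f)"
      by (rule B_cong[OF d]) (simp_all only: ib)
    then show ?thesis by (simp only: B_lin_left[OF b b ibd] B_lin_right[OF b b b]) simp
  qed
  have b5: "B (line_deriv z (\<i> *s u) 2 0) a = - B (line_deriv z u 2 0) a"
  proof -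
    have "B (line_deriv z (\<i> *s u) 2 0) a = B (\<lambda>f. (-1) * line_deriv z u 2 0 f + 0 * b f) a"
      by (rule B_cong[OF a]) (simp_all add: line_deriv_ii[OF z])
    then show ?thesis by (simp only: B_lin_left[OF c b a]) simp
  qed
  define K where "K = bergman_diag D z"
  have K: "0 < K" unfolding K_def by (rule bergman_diag_pos[OF z])
  define p where "p = Re (B (line_deriv z u 2 0) a)"
  define q where "q = Re (B b b)"
  define x where "x = Re (B b a)"
  define y where "y = Im (B b a)"
  \<comment> \<open>In direction \<open>\<i> *s u\<close> the number \<open>B b a\<close> is
    multiplied by \<open>\<i>\<close>, so its real part becomes \<open>- y\<close>. The two squares
    therefore combine to the squared modulus of \<open>B b a\<close>.\<close>
  have "bergman_metric D z u = ((2 * (p + q) / K - (2 * x)\<^sup>2 / K\<^sup>2) + (2 * (- p + q) / K - (2 * (- y))\<^sup>2 / K\<^sup>2)) / 4"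
    unfolding bergman_metric_def ln_bergman_diag_second_deriv[OF \<rho>] ln_bergman_diag_second_deriv[OF \<rho>']
      x0 b1 b2 b3 b4 b5 K_def[symmetric] p_def q_def x_def y_def by simp
  also have "\<dots> = q / K - (x\<^sup>2 + y\<^sup>2) / K\<^sup>2"
    using K by (simp add: field_simps power2_eq_square)
  finally show ?thesis by (simp add: K_def q_def x_def y_def cmod_power2)
qed

section \<open>Upper and lower bounds for the Bergman metric\<close>

lemma grad_bnd:
  assumes r: "0 < r" "ball z r \<subseteq> D"
  shows "bnd (4 * ball_const (r / 2) / r * norm u) (\<lambda>f. grad_app f z u)"
  unfolding bnd_def
proof (intro conjI ballI)
  show "0 \<le> 4 * ball_const (r / 2) / r * norm u" using r ball_const_nonneg by simp
  fix f assume f: "f \<in> A2"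
  have z: "z \<in> D" using r by (meson centre_in_ball subsetD)
  show "cmod (grad_app f z u) \<le> 4 * ball_const (r / 2) / r * norm u * nrm f"
  proof (cases "u = 0")
    case True
    have "grad_app f z (0 *s u) = 0 * grad_app f z u"
      by (rule grad_app_vector_scalar_mult[OF Bergman_holo[OF f] z])
    with True show ?thesis by simp
  next
    case False
    \<comment> \<open>Half of \<open>r\<close> is spent on the disc in direction \<open>u\<close>,
      leaving radius \<open>r / 2\<close> for evaluation at its points. Cauchy's estimate at half of
      \<open>\<rho>\<close> then yields the factor 4.\<close>
    define \<rho> where "\<rho> = r / (2 * norm u)"
    have \<rho>: "0 < \<rho>" "\<rho> * norm u \<le> r / 2" using r False by (auto simp: \<rho>_def)
    have sub: "ball (z + s *s u) (r / 2) \<subseteq> D" if "s \<in> ball 0 \<rho>" for s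
      by (rule good_radiusI[OF r \<rho> that])
    have g: "good_radius z u \<rho>"
      unfolding good_radius_def using \<rho> r by (intro conjI exI[of _ "r/2"] ballI sub) auto
    have "cmod ((deriv ^^ 1) (\<lambda>s. f (z + s *s u)) 0) \<le> fact 1 * (ball_const (r / 2) * nrm f) / (\<rho> / 2) ^ 1"
      using \<rho> r
      by (intro higher_deriv_bound_half[OF line_holomorphic[OF g f] bnd_apply[OF bnd_eval[OF _ sub] f]]) auto
    then show ?thesis
      using line_deriv_grad_app[OF z f, of u] False r
      by (simp add: line_deriv_def \<rho>_def field_simps)
  qed
qed

lemma bergman_metric_upper:
  assumes r: "0 < r" "ball z r \<subseteq> D"
  shows "bergman_metric D z u \<le> (4 * ball_const (r / 2) / r)\<^sup>2 * measure lborel D * (norm u)\<^sup>2"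
proof -
  have z: "z \<in> D" using r by (meson centre_in_ball subsetD)
  define b where "b = (\<lambda>f. grad_app f z u)"
  define K where "K = bergman_diag D z"
  have K: "0 < K" "1 \<le> K * measure lborel D"
    unfolding K_def by (rule bergman_diag_pos[OF z], rule bergman_diag_lower[OF z])
  have b: "b \<in> dual" unfolding b_def by (rule grad_in_dual[OF z])
  define c where "c = 4 * ball_const (r / 2) / r"
  have "bnd (c * norm u) b" unfolding b_def c_def by (rule grad_bnd[OF r])
  from B_bound[OF b b this this] have bb: "Re (B b b) \<le> c\<^sup>2 * (norm u)\<^sup>2"
    using complex_Re_le_cmod[of "B b b"] by (simp add: power2_eq_square algebra_simps)
  have "bergman_metric D z u \<le> Re (B b b) / K"
    unfolding bergman_metric_eq[OF z] b_def K_def by simp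
  also have "\<dots> \<le> c\<^sup>2 * (norm u)\<^sup>2 / K"
    using bb K by (intro divide_right_mono) auto
  also have "\<dots> \<le> c\<^sup>2 * (norm u)\<^sup>2 * measure lborel D"
  proof -
    have "1 / K \<le> measure lborel D" using K by (simp add: field_simps)
    from mult_left_mono[OF this, of "c\<^sup>2 * (norm u)\<^sup>2"] show ?thesis by simp
  qed
  finally show ?thesis by (simp add: c_def mult.commute mult.left_commute)
qed

text \<open>The linear form \<open>w \<mapsto> \<langle>w - z, u\<rangle>\<close> vanishes at \<open>z\<close>, so it cannot distinguish the derivative
  functional from its component orthogonal to the evaluation at \<open>z\<close>.\<close>

lemma bergman_metric_lower:
  assumes z: "z \<in> D"
  shows "\<exists>c>0. \<forall>u. c * (norm u)\<^sup>2 \<le> bergman_metric D z u"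
proof -
  obtain R where R: "0 < R" "\<And>w. w \<in> D \<Longrightarrow> norm (w - z) \<le> R"
  proof -
    obtain R0 where R0: "\<And>w. w \<in> D \<Longrightarrow> norm w \<le> R0" using bounded_D by (auto simp: bounded_iff)
    show ?thesis
    proof (rule that[of "\<bar>R0\<bar> + norm z + 1"])
      show "0 < \<bar>R0\<bar> + norm z + 1" by (smt (verit) norm_ge_zero)
      show "norm (w - z) \<le> \<bar>R0\<bar> + norm z + 1" if "w \<in> D" for w
        using norm_triangle_ineq4[of w z] R0[OF that] by linarith
    qed
  qed
  define K where "K = bergman_diag D z"
  define vol where "vol = measure lborel D"
  have K: "0 < K" "1 \<le> K * vol"
    unfolding K_def vol_def by (rule bergman_diag_pos[OF z], rule bergman_diag_lower[OF z])
  have vol: "0 < vol" using K by (smt (verit) zero_less_mult_pos)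
  define a :: "('n cvec \<Rightarrow> complex) \<Rightarrow> complex" where "a = (\<lambda>f. f z)"
  have a: "a \<in> dual" unfolding a_def by (rule eval_in_dual[OF z])
  have Ka: "B a a = of_real K"
    using B_self[OF a] bergman_diag_eq[OF z] by (simp add: K_def a_def)
  show ?thesis
  \<comment> \<open>The constant comes from |u|^4 = |P p|^2 \<le> (K H) (|u| R)^2 vol, where H is
    the metric at \<open>u\<close> and the last two factors bound the squared norm of the linear
    form \<open>p\<close>.\<close>
  proof (intro exI[of _ "1 / (K * R\<^sup>2 * vol)"] conjI allI)
    show "0 < 1 / (K * R\<^sup>2 * vol)" using K R vol by simp
    fix u :: "'n cvec"
    define b where "b = (\<lambda>f. grad_app f z u)"
    have b: "b \<in> dual" unfolding b_def by (rule grad_in_dual[OF z])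
    \<comment> \<open>The coefficient of the orthogonal projection of \<open>b\<close> onto
      \<open>a\<close>.\<close>
    define k where "k = B b a / of_real K"
    define P where "P = (\<lambda>f. 1 * b f + (- k) * a f)"
    have P: "P \<in> dual" unfolding P_def by (rule dual_lincomb[OF b a])
    have ab: "B a b = cnj (B b a)" by (rule B_cnj[OF a b])
    have "B P a = 1 * B b a + (- k) * B a a" unfolding P_def by (rule B_lin_left[OF b a a])
    then have Pa: "B P a = 0" using K by (simp add: Ka k_def)
    have "B P P = cnj 1 * B P b + cnj (- k) * B P a"
      by (subst (2) P_def) (rule B_lin_right[OF b a P])
    also have "\<dots> = B P b" by (simp add: Pa)
    also have "\<dots> = 1 * B b b + (- k) * B a b" unfolding P_def by (rule B_lin_left[OF b a b])
    also have "\<dots> = B b b - of_real ((cmod (B b a))\<^sup>2 / K)"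
      by (simp add: k_def ab complex_norm_square[of "B b a"] del: of_real_power)
    finally have "Re (B P P) = Re (B b b) - (cmod (B b a))\<^sup>2 / K" by simp
    also have "\<dots> = K * bergman_metric D z u"
      unfolding bergman_metric_eq[OF z] b_def a_def K_def[symmetric]
      using K by (simp add: field_simps power2_eq_square)
    finally have PP: "Re (B P P) = K * bergman_metric D z u" .
    \<comment> \<open>The conjugated coefficients make the derivative of \<open>p\<close> in
      direction \<open>u\<close> equal to the squared norm of \<open>u\<close>.\<close>
    define p where "p w = (\<Sum>i\<in>UNIV. cnj (u $ i) * (w $ i - z $ i))" for w
    have dp: "(p has_derivative (\<lambda>h. \<Sum>i\<in>UNIV. cnj (u $ i) * h $ i)) (at w)" for w
      unfolding p_def
      by (auto intro!: derivative_eq_intros bounded_linear_imp_has_derivative bounded_linear_vec_nth)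
    have "holo p D"
      by (rule holoI[OF dp]) (simp add: sum_distrib_left mult.commute mult.left_commute)
    moreover have "cmod (p w) \<le> norm u * R" if w: "w \<in> D" for w
    proof -
      have "cmod (p w) \<le> (\<Sum>i\<in>UNIV. \<bar>cmod (u $ i)\<bar> * \<bar>cmod ((w - z) $ i)\<bar>)"
        unfolding p_def by (rule order_trans[OF norm_sum]) (simp add: norm_mult)
      also have "\<dots> \<le> norm u * norm (w - z)"
        unfolding norm_vec_def by (rule L2_set_mult_ineq)
      also have "\<dots> \<le> norm u * R" using R(2)[OF w] by (intro mult_left_mono) auto
      finally show ?thesis .
    qed
    ultimately have p: "p \<in> A2" "(nrm p)\<^sup>2 \<le> (norm u * R)\<^sup>2 * vol"
      unfolding vol_def using bounded_holo_in_Bergman[of p "norm u * R"] by blast+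
    have "b p = (\<Sum>i\<in>UNIV. cnj (u $ i) * u $ i)" unfolding b_def by (rule grad_app_eqI[OF dp])
    also have "\<dots> = (\<Sum>i\<in>UNIV. complex_of_real ((cmod (u $ i))\<^sup>2))"
      by (simp only: complex_norm_square mult.commute)
    also have "\<dots> = of_real (\<Sum>i\<in>UNIV. (cmod (u $ i))\<^sup>2)" by (rule of_real_sum[symmetric])
    also have "(\<Sum>i\<in>UNIV. (cmod (u $ i))\<^sup>2) = (norm u)\<^sup>2"
      by (simp add: norm_vec_def L2_set_def sum_nonneg)
    finally have "P p = of_real ((norm u)\<^sup>2)" by (simp add: P_def a_def) (simp add: p_def)
    then have "((norm u)\<^sup>2)\<^sup>2 = (cmod (P p))\<^sup>2" by (simp only: norm_of_real power2_abs)
    also have "\<dots> \<le> K * bergman_metric D z u * (nrm p)\<^sup>2"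
      using dual_norm_bound[OF P p(1)] PP by simp
    also have "\<dots> \<le> K * bergman_metric D z u * ((norm u * R)\<^sup>2 * vol)"
      using p(2) B_self_nonneg[OF P] PP by (intro mult_left_mono) auto
    finally have *: "(norm u)\<^sup>2 * (norm u)\<^sup>2 \<le> (norm u)\<^sup>2 * (K * R\<^sup>2 * vol * bergman_metric D z u)"
      by (simp add: power2_eq_square algebra_simps)
    have "(norm u)\<^sup>2 \<le> K * R\<^sup>2 * vol * bergman_metric D z u"
    proof (cases "u = 0")
      case True
      have "0 \<le> bergman_metric D z u" using B_self_nonneg[OF P] PP K by (simp add: zero_le_mult_iff)
      then show ?thesis using True K vol by simp
    next
      case False
      then show ?thesis by (intro mult_left_le_imp_le[OF *]) simp
    qed
    then show "1 / (K * R\<^sup>2 * vol) * (norm u)\<^sup>2 \<le> bergman_metric D z u"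
      using K R vol by (simp add: field_simps)
  qed
qed

end

subsection \<open>Bloch functions and weighted composition operators\<close>

locale bounded_domain = bounded_open_set D for D :: "'n::finite cvec set" +
  assumes connected_D: "connected D" and zero_in_D: "0 \<in> D"
begin

abbreviation \<beta> :: "('n cvec \<Rightarrow> complex) \<Rightarrow> real" where
  "\<beta> f \<equiv> Sup (Qf D f ` D)"

section \<open>Finiteness of \<open>Qf\<close> and behaviour under affine maps\<close>

lemma bergman_metric_pos:
  assumes "z \<in> D" "u \<noteq> 0"
  shows "0 < bergman_metric D z u"
proof -
  obtain c where "0 < c" "c * (norm u)\<^sup>2 \<le> bergman_metric D z u"
    using bergman_metric_lower[OF assms(1)] by blast
  then show ?thesis using assms(2) by (smt (verit) mult_pos_pos zero_less_norm_iff zero_less_power)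
qed

lemma bergman_metric_nonneg: "z \<in> D \<Longrightarrow> 0 \<le> bergman_metric D z u"
  using bergman_metric_lower[of z]
  by (meson less_eq_real_def mult_nonneg_nonneg order_trans zero_le_power2)

text \<open>The derivative is at most a multiple of the norm of \<open>u\<close> and the root of the
  metric at least a positive multiple of it, so the quotients are bounded and \<open>Qf\<close> is a
  genuine supremum.\<close>

lemma Qf_set_bdd_above:
  assumes f: "holo f D" and z: "z \<in> D"
  shows "bdd_above {cmod (grad_app f z u) / sqrt (bergman_metric D z u) | u. u \<noteq> 0}"
proof -
  obtain c where c: "0 < c" "\<And>u. c * (norm u)\<^sup>2 \<le> bergman_metric D z u"
    using bergman_metric_lower[OF z] by blast
  have bl: "bounded_linear (grad_app f z)"
    using holo_has_derivative[OF f z] by (rule has_derivative_bounded_linear)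
  show ?thesis
  proof (rule bdd_aboveI)
    fix x assume "x \<in> {cmod (grad_app f z u) / sqrt (bergman_metric D z u) | u. u \<noteq> 0}"
    then obtain u where u: "u \<noteq> 0" "x = cmod (grad_app f z u) / sqrt (bergman_metric D z u)" by blast
    have "sqrt c * norm u \<le> sqrt (bergman_metric D z u)"
      using real_sqrt_le_mono[OF c(2)[of u]] by (simp add: real_sqrt_mult)
    moreover have "0 < sqrt c * norm u" using c u by simp
    ultimately have "x \<le> (onorm (grad_app f z) * norm u) / (sqrt c * norm u)"
      unfolding u(2) using onorm[OF bl, of u] onorm_pos_le[OF bl] by (intro frac_le) auto
    then show "x \<le> onorm (grad_app f z) / sqrt c" using u by simp
  qed
qed

lemma Qf_upper:
  assumes f: "holo f D" and z: "z \<in> D" and u: "u \<noteq> 0"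
  shows "cmod (grad_app f z u) / sqrt (bergman_metric D z u) \<le> Qf D f z"
  unfolding Qf_def using u by (intro cSup_upper[OF _ Qf_set_bdd_above[OF f z]]) blast

lemma Qf_least:
  fixes f :: "'n cvec \<Rightarrow> complex"
  assumes "\<And>u. u \<noteq> 0 \<Longrightarrow> cmod (grad_app f z u) / sqrt (bergman_metric D z u) \<le> y"
  shows "Qf D f z \<le> y"
proof -
  have "axis undefined 1 \<noteq> (0 :: 'n cvec)" by (simp add: axis_eq_0_iff)
  then have "{cmod (grad_app f z u) / sqrt (bergman_metric D z u) | u. u \<noteq> 0} \<noteq> {}" by blast
  then show ?thesis unfolding Qf_def using assms by (intro cSup_least) auto
qed

lemma Qf_nonneg:
  assumes "holo f D" "z \<in> D"
  shows "0 \<le> Qf D f z"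
proof -
  have u: "axis undefined 1 \<noteq> (0 :: 'n cvec)" by (simp add: axis_eq_0_iff)
  show ?thesis
    by (rule order_trans[OF _ Qf_upper[OF assms u]])
       (use bergman_metric_pos[OF assms(2) u] in simp)
qed

lemma grad_le_Qf:
  assumes f: "holo f D" and z: "z \<in> D"
  shows "cmod (grad_app f z u) \<le> Qf D f z * sqrt (bergman_metric D z u)"
proof (cases "u = 0")
  case True
  have "grad_app f z (0 *s u) = 0 * grad_app f z u" by (rule grad_app_vector_scalar_mult[OF f z])
  then have "grad_app f z u = 0" using True by simp
  then show ?thesis using Qf_nonneg[OF f z] bergman_metric_nonneg[OF z] by simp
next
  case False
  with Qf_upper[OF f z False] bergman_metric_pos[OF z False] show ?thesis
    by (simp add: divide_le_eq)
qed

lemma Qf_affine_le: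
  assumes f: "holo f D" and z: "z \<in> D"
  shows "Qf D (\<lambda>w. a * f w + b) z \<le> cmod a * Qf D f z"
proof (rule Qf_least)
  fix u :: "'n cvec" assume u: "u \<noteq> 0"
  have "grad_app (\<lambda>w. a * f w + b * 1) z u = a * grad_app f z u"
    by (simp only: grad_app_lincomb[OF f holo_const z] grad_app_const) simp
  then have "cmod (grad_app (\<lambda>w. a * f w + b) z u) / sqrt (bergman_metric D z u)
     = cmod a * (cmod (grad_app f z u) / sqrt (bergman_metric D z u))"
    by (simp add: norm_mult)
  also have "\<dots> \<le> cmod a * Qf D f z" using Qf_upper[OF f z u] by (intro mult_left_mono) auto
  finally show "cmod (grad_app (\<lambda>w. a * f w + b) z u) / sqrt (bergman_metric D z u) \<le> cmod a * Qf D f z" .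
qed

lemma holo_affine: "holo f D \<Longrightarrow> holo (\<lambda>w. a * f w + b) D"
  using holo_lincomb[OF _ holo_const, of f D a b 1] by simp

lemma Qf_const: "z \<in> D \<Longrightarrow> Qf D (\<lambda>_. c) z = 0"
  using Qf_affine_le[OF holo_const, of z 0 0 c] Qf_nonneg[OF holo_const, of z c] by simp

lemma bloch_holo: "f \<in> bloch_space D \<Longrightarrow> holo f D"
  by (simp add: bloch_space_def)

lemma Qf_le_seminorm: "f \<in> bloch_space D \<Longrightarrow> z \<in> D \<Longrightarrow> Qf D f z \<le> \<beta> f"
  by (auto simp: bloch_space_def intro: cSUP_upper)

lemma seminorm_nonneg: "f \<in> bloch_space D \<Longrightarrow> 0 \<le> \<beta> f"
  using Qf_le_seminorm[OF _ zero_in_D] Qf_nonneg[OF bloch_holo zero_in_D] by fastforce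

lemma
  assumes f: "f \<in> bloch_space D"
  shows bloch_affine: "(\<lambda>w. a * f w + b) \<in> bloch_space D"
    and seminorm_affine_le: "\<beta> (\<lambda>w. a * f w + b) \<le> cmod a * \<beta> f"
proof -
  have le: "Qf D (\<lambda>w. a * f w + b) z \<le> cmod a * \<beta> f" if z: "z \<in> D" for z
    using Qf_affine_le[OF bloch_holo[OF f] z, of a b] mult_left_mono[OF Qf_le_seminorm[OF f z], of "cmod a"]
    by simp
  then show "(\<lambda>w. a * f w + b) \<in> bloch_space D"
    using holo_affine[OF bloch_holo[OF f]] by (auto simp: bloch_space_def intro!: bdd_aboveI2)
  show "\<beta> (\<lambda>w. a * f w + b) \<le> cmod a * \<beta> f"
    using zero_in_D le by (intro cSUP_least) auto
qed

lemma bloch_const: "(\<lambda>_. c) \<in> bloch_space D"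
  by (auto simp: bloch_space_def holo_const Qf_const)

lemma bloch_norm_const: "bloch_norm D (\<lambda>_. c) = cmod c"
proof -
  have "D \<noteq> {}" using zero_in_D by blast
  then show ?thesis by (simp add: bloch_norm_def Qf_const)
qed

lemma little_bloch_const: "(\<lambda>_. c) \<in> little_bloch_star D"
proof -
  have "((Qf D (\<lambda>_. c)) \<longlongrightarrow> 0) (at \<xi> within D)" for \<xi>
    by (rule tendsto_eventually) (simp add: eventually_at_filter Qf_const)
  then show ?thesis by (simp add: little_bloch_star_def bloch_const)
qed

lemma little_bloch_affine:
  assumes "f \<in> little_bloch_star D"
  shows "(\<lambda>w. a * f w + b) \<in> little_bloch_star D"
proof -
  have f: "f \<in> bloch_space D" using assms by (simp add: little_bloch_star_def)
  have "((Qf D (\<lambda>w. a * f w + b)) \<longlongrightarrow> 0) (at \<xi> within D)" if "\<xi> \<in> dist_boundary D" for \<xi>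
  proof (rule Lim_null_comparison)
    show "\<forall>\<^sub>F z in at \<xi> within D. norm (Qf D (\<lambda>w. a * f w + b) z) \<le> cmod a * Qf D f z"
      using Qf_affine_le[OF bloch_holo[OF f]] Qf_nonneg[OF bloch_holo[OF bloch_affine[OF f]]]
      by (auto simp: eventually_at_filter)
    have "((Qf D f) \<longlongrightarrow> 0) (at \<xi> within D)"
      using assms that by (simp add: little_bloch_star_def)
    from tendsto_mult_left[OF this, of "cmod a"]
    show "((\<lambda>z. cmod a * Qf D f z) \<longlongrightarrow> 0) (at \<xi> within D)" by simp
  qed
  with bloch_affine[OF f] show ?thesis by (simp add: little_bloch_star_def)
qed

text \<open>The upper bound on the metric converts the seminorm into a bound on the Euclidean
  operator norm of the derivative, and balls are convex. \<open>C\<close> is the same for all Bloch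
  functions.\<close>

lemma bloch_locally_Lipschitz:
  assumes a: "a \<in> D"
  shows "\<exists>r>0. ball a r \<subseteq> D \<and> (\<exists>C\<ge>0. \<forall>f\<in>bloch_space D. \<forall>x\<in>ball a r. \<forall>y\<in>ball a r.
    cmod (f x - f y) \<le> \<beta> f * C * norm (x - y))"
proof -
  obtain r0 where r0: "0 < r0" "ball a r0 \<subseteq> D" using ex_ball[OF a] by blast
  \<comment> \<open>Halving leaves a ball of the same radius inside \<open>D\<close> around each
    point of \<open>ball a r\<close>, so the metric bound is uniform there.\<close>
  define r where "r = r0 / 2"
  have r: "0 < r" using r0 by (simp add: r_def)
  have sub: "ball z r \<subseteq> D" if "z \<in> ball a r" for z
  proof
    fix w assume "w \<in> ball z r"
    then have "dist a w < r0" using that dist_triangle[of a w z] by (simp add: r_def)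
    then show "w \<in> D" using r0 by auto
  qed
  have inD: "z \<in> D" if "z \<in> ball a r" for z using sub[OF that] r by (meson centre_in_ball subsetD)
  define C where "C = sqrt ((4 * ball_const (r / 2) / r)\<^sup>2 * measure lborel D)"
  have "cmod (f x - f y) \<le> \<beta> f * C * norm (x - y)"
    if f: "f \<in> bloch_space D" and x: "x \<in> ball a r" and y: "y \<in> ball a r" for f x y
  proof (rule differentiable_bound[OF convex_ball _ _ x y])
    fix z assume z: "z \<in> ball a r"
    show "(f has_derivative grad_app f z) (at z within ball a r)"
      using holo_has_derivative[OF bloch_holo[OF f] inD[OF z]] by (rule has_derivative_at_withinI)
    show "onorm (grad_app f z) \<le> \<beta> f * C"
    proof (rule onorm_le)
      fix u
      have "cmod (grad_app f z u) \<le> Qf D f z * sqrt (bergman_metric D z u)"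
        by (rule grad_le_Qf[OF bloch_holo[OF f] inD[OF z]])
      also have "\<dots> \<le> \<beta> f * (C * norm u)"
      proof (rule mult_mono)
        show "Qf D f z \<le> \<beta> f" by (rule Qf_le_seminorm[OF f inD[OF z]])
        show "sqrt (bergman_metric D z u) \<le> C * norm u"
          using real_sqrt_le_mono[OF bergman_metric_upper[OF r sub[OF z], of u]]
          by (simp add: C_def real_sqrt_mult)
        show "0 \<le> sqrt (bergman_metric D z u)" using bergman_metric_nonneg[OF inD[OF z]] by simp
      qed (rule seminorm_nonneg[OF f])
      finally show "cmod (grad_app f z u) \<le> \<beta> f * C * norm u" by (simp add: mult.assoc)
    qed
  qed
  moreover have "0 \<le> C" by (simp add: C_def)
  moreover have "ball a r \<subseteq> D" using inD by blast
  ultimately show ?thesis using r by blast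
qed

text \<open>The local Lipschitz bounds are chained through the connected domain. The constant may
  depend on \<open>w\<close> but not on \<open>f\<close>, which is what makes the suprema
  \<open>omega_fun\<close> and \<open>omega0_fun\<close> finite.\<close>

lemma bloch_growth:
  assumes w: "w \<in> D"
  shows "\<exists>C. \<forall>f\<in>bloch_space D. cmod (f w - f 0) \<le> C * \<beta> f"
proof (rule connected_induction_simple[OF connected_D zero_in_D w])
  show "\<exists>C. \<forall>f\<in>bloch_space D. cmod (f 0 - f 0) \<le> C * \<beta> f" by (intro exI[of _ 0]) simp
  fix a assume "a \<in> D"
  from bloch_locally_Lipschitz[OF this] obtain r C where r: "0 < r" "ball a r \<subseteq> D" and "0 \<le> C"
    and C: "\<And>f x y. f \<in> bloch_space D \<Longrightarrow> x \<in> ball a r \<Longrightarrow> y \<in> ball a r \<Longrightarrow>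
      cmod (f x - f y) \<le> \<beta> f * C * norm (x - y)"
    by blast
  show "\<exists>T. openin (top_of_set D) T \<and> a \<in> T \<and> (\<forall>x\<in>T. \<forall>y\<in>T.
      (\<exists>C. \<forall>f\<in>bloch_space D. cmod (f x - f 0) \<le> C * \<beta> f) \<longrightarrow>
      (\<exists>C. \<forall>f\<in>bloch_space D. cmod (f y - f 0) \<le> C * \<beta> f))"
  proof (intro exI[of _ "ball a r"] conjI ballI impI)
    show "openin (top_of_set D) (ball a r)" using r by (simp add: open_subset)
    show "a \<in> ball a r" using r by simp
    fix x y assume x: "x \<in> ball a r" and y: "y \<in> ball a r"
    assume "\<exists>C. \<forall>f\<in>bloch_space D. cmod (f x - f 0) \<le> C * \<beta> f"
    then obtain C' where C': "\<And>f. f \<in> bloch_space D \<Longrightarrow> cmod (f x - f 0) \<le> C' * \<beta> f" by blast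
    have "cmod (f y - f 0) \<le> (C' + C * norm (y - x)) * \<beta> f" if f: "f \<in> bloch_space D" for f
    proof -
      have "cmod (f y - f 0) \<le> cmod (f y - f x) + cmod (f x - f 0)"
        using norm_triangle_ineq[of "f y - f x" "f x - f 0"] by simp
      then show ?thesis using C[OF f y x] C'[OF f] by (simp add: algebra_simps)
    qed
    then show "\<exists>C. \<forall>f\<in>bloch_space D. cmod (f y - f 0) \<le> C * \<beta> f" by blast
  qed
qed

text \<open>\<open>X\<close> stands for the Bloch space or its little subspace. Constants in
  \<open>X\<close> recover \<psi> as an image, and closure under affine maps allows normalising f to
  (f - f(0)) / \<beta> f.\<close>

lemma weighted_composition_criterion:
  fixes X :: "('n cvec \<Rightarrow> complex) set"
  assumes X: "X \<subseteq> bloch_space D" and const: "\<And>c. (\<lambda>_. c) \<in> X"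
    and affine: "\<And>f a b. f \<in> X \<Longrightarrow> (\<lambda>w. a * f w + b) \<in> X"
    and \<mu>: "\<And>z. z \<in> D \<Longrightarrow> 0 < \<mu> z"
    and \<psi>: "holo \<psi> D" and \<phi>: "holo_map \<phi> D" "\<phi> ` D \<subseteq> D"
  defines "\<Omega> \<equiv> \<lambda>z. Sup {cmod (f z) | f. f \<in> X \<and> f 0 = 0 \<and> bloch_norm D f \<le> 1}"
  defines "W \<equiv> wcomp \<psi> \<phi>"
  shows "(bounded_op W X (bloch_norm D) (Hinf_space D \<mu>) (Hinf_norm D \<mu>) \<longleftrightarrow>
      \<psi> \<in> Hinf_space D \<mu> \<and> bdd_above ((\<lambda>z. \<mu> z * cmod (\<psi> z) * \<Omega> (\<phi> z)) ` D))
    \<and> (bounded_op W X (bloch_norm D) (Hinf_space D \<mu>) (Hinf_norm D \<mu>) \<longrightarrow>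
      op_norm W X (bloch_norm D) (Hinf_norm D \<mu>)
        = max (Hinf_norm D \<mu> \<psi>) (Sup ((\<lambda>z. \<mu> z * cmod (\<psi> z) * \<Omega> (\<phi> z)) ` D)))"
proof -
  let ?N = "bloch_norm D" and ?H = "Hinf_norm D \<mu>" and ?HS = "Hinf_space D \<mu>"
  let ?S = "\<lambda>z. {cmod (f z) | f. f \<in> X \<and> f 0 = 0 \<and> ?N f \<le> 1}"
  let ?U = "(\<lambda>z. \<mu> z * cmod (\<psi> z) * \<Omega> (\<phi> z)) ` D"
  have XB: "f \<in> bloch_space D" if "f \<in> X" for f using X that by blast
  have \<phi>D: "\<phi> z \<in> D" if "z \<in> D" for z using \<phi>(2) that by blast
  have S_zero: "0 \<in> ?S z" for z
    using const[of 0] bloch_norm_const[of 0] by force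
  have S_bdd: "bdd_above (?S z)" if z: "z \<in> D" for z
  proof -
    obtain C where C: "\<And>f. f \<in> bloch_space D \<Longrightarrow> cmod (f z - f 0) \<le> C * \<beta> f"
      using bloch_growth[OF z] by blast
    show ?thesis
    proof (rule bdd_aboveI)
      fix x assume "x \<in> ?S z"
      then obtain f where f: "f \<in> X" "f 0 = 0" "?N f \<le> 1" "x = cmod (f z)" by blast
      have "x \<le> C * \<beta> f" using C[OF XB[OF f(1)]] f by simp
      also have "\<dots> \<le> \<bar>C\<bar> * \<beta> f"
        using seminorm_nonneg[OF XB[OF f(1)]] by (intro mult_right_mono) auto
      also have "\<dots> \<le> \<bar>C\<bar> * 1" using f by (intro mult_left_mono) (auto simp: bloch_norm_def)
      finally show "x \<le> \<bar>C\<bar>" by simp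
    qed
  qed
  have \<Omega>_nonneg: "0 \<le> \<Omega> z" if "z \<in> D" for z
    unfolding \<Omega>_def by (rule cSup_upper[OF S_zero S_bdd[OF that]])
  have growth: "cmod (f z - f 0) \<le> \<beta> f * \<Omega> z" if f: "f \<in> X" and z: "z \<in> D" for f z
  proof (cases "\<beta> f = 0")
    case True
    \<comment> \<open>Normalisation is impossible here, but a vanishing seminorm forces
      \<open>f z = f 0\<close> by the growth bound.\<close>
    then show ?thesis using bloch_growth[OF z] XB[OF f] by fastforce
  next
    case False
    then have pos: "0 < \<beta> f" using seminorm_nonneg[OF XB[OF f]] by simp
    define g where "g = (\<lambda>w. of_real (1 / \<beta> f) * f w + - (of_real (1 / \<beta> f) * f 0))"
    have g: "g \<in> X" "g 0 = 0" unfolding g_def by (rule affine[OF f]) simp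
    have "\<beta> g \<le> cmod (of_real (1 / \<beta> f)) * \<beta> f"
      unfolding g_def by (rule seminorm_affine_le[OF XB[OF f]])
    also have "\<dots> = 1" using pos by (simp add: norm_divide)
    finally have "?N g \<le> 1" using g by (simp add: bloch_norm_def)
    then have "cmod (g z) \<le> \<Omega> z"
      unfolding \<Omega>_def using g by (intro cSup_upper[OF _ S_bdd[OF z]]) blast
    moreover have "g z = of_real (1 / \<beta> f) * (f z - f 0)" unfolding g_def by (simp only: right_diff_distrib) simp
    ultimately have "cmod (f z - f 0) / \<beta> f \<le> \<Omega> z"
      using pos by (simp add: norm_mult norm_divide)
    then show ?thesis using pos by (simp add: divide_le_eq mult.commute)
  qed
  have H_upper: "\<mu> z * cmod (h z) \<le> ?H h" if "h \<in> ?HS" "z \<in> D" for h z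
    using that unfolding Hinf_norm_def Hinf_space_def by (intro cSUP_upper) auto
  have H_nonneg: "0 \<le> ?H h" if "h \<in> ?HS" for h
    using H_upper[OF that zero_in_D] \<mu>[OF zero_in_D] by (smt (verit) mult_nonneg_nonneg norm_ge_zero)
  have W1: "W (\<lambda>_. 1) = \<psi>" by (simp add: W_def wcomp_def)
  have W_abs: "\<mu> z * cmod (W f z) = \<mu> z * cmod (\<psi> z) * cmod (f (\<phi> z))" for f z
    by (simp add: W_def wcomp_def norm_mult)
  \<comment> \<open>Used twice: with the constant of a bounded operator as \<open>y\<close>, and
    with an arbitrary upper bound of the set defining the operator norm.\<close>
  have U_le: "\<mu> z * cmod (\<psi> z) * \<Omega> (\<phi> z) \<le> y"
    if z: "z \<in> D" and y: "0 \<le> y"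
      and W: "\<And>f. f \<in> X \<Longrightarrow> ?N f \<le> 1 \<Longrightarrow> W f \<in> ?HS \<and> ?H (W f) \<le> y" for y z
  proof (cases "\<psi> z = 0")
    case False
    then have c: "0 < \<mu> z * cmod (\<psi> z)" using \<mu>[OF z] by simp
    have "\<Omega> (\<phi> z) \<le> y / (\<mu> z * cmod (\<psi> z))"
      unfolding \<Omega>_def
    proof (rule cSup_least)
      show "?S (\<phi> z) \<noteq> {}" using S_zero by blast
      fix x assume "x \<in> ?S (\<phi> z)"
      then obtain f where f: "f \<in> X" "?N f \<le> 1" "x = cmod (f (\<phi> z))" by blast
      have "\<mu> z * cmod (\<psi> z) * x \<le> y"
        using H_upper[of "W f" z] W[OF f(1,2)] z by (simp add: W_abs f(3))
      then show "x \<le> y / (\<mu> z * cmod (\<psi> z))" using c by (simp add: le_divide_eq mult.commute)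
    qed
    then show ?thesis using c by (simp add: le_divide_eq mult.commute)
  qed (use y in simp)
  define m where "m = max (?H \<psi>) (Sup ?U)"
  have fwd: "\<psi> \<in> ?HS \<and> bdd_above ?U" if bop: "bounded_op W X ?N ?HS ?H"
  proof -
    obtain C where C: "\<And>f. f \<in> X \<Longrightarrow> W f \<in> ?HS" "\<And>f. f \<in> X \<Longrightarrow> ?H (W f) \<le> C * ?N f"
      using bop by (auto simp: bounded_op_def)
    have \<psi>H: "\<psi> \<in> ?HS" using C(1)[OF const[of 1]] by (simp add: W1)
    have C0: "0 \<le> C" using C(2)[OF const[of 1]] H_nonneg[OF \<psi>H] by (simp add: W1 bloch_norm_const)
    have WC: "W f \<in> ?HS \<and> ?H (W f) \<le> C" if "f \<in> X" "?N f \<le> 1" for f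
      using C(1)[OF that(1)] C(2)[OF that(1)] mult_left_mono[OF that(2) C0] by simp
    have "bdd_above ?U" by (rule bdd_aboveI2[where M=C]) (rule U_le[OF _ C0 WC])
    with \<psi>H show ?thesis by simp
  qed
  have est: "W f \<in> ?HS \<and> ?H (W f) \<le> m * ?N f"
    if \<psi>H: "\<psi> \<in> ?HS" and bdd: "bdd_above ?U" and f: "f \<in> X" for f
  proof -
    have le: "\<mu> z * cmod (W f z) \<le> m * ?N f" if z: "z \<in> D" for z
    proof -
      have c: "0 \<le> \<mu> z * cmod (\<psi> z)" using \<mu>[OF z] by simp
      have "cmod (f (\<phi> z)) \<le> cmod (f 0) + \<beta> f * \<Omega> (\<phi> z)"
        using growth[OF f \<phi>D[OF z]] norm_triangle_ineq2[of "f (\<phi> z)" "f 0"] by linarith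
      then have "\<mu> z * cmod (W f z) \<le> \<mu> z * cmod (\<psi> z) * (cmod (f 0) + \<beta> f * \<Omega> (\<phi> z))"
        unfolding W_abs using c by (rule mult_left_mono)
      also have "\<dots> = (\<mu> z * cmod (\<psi> z)) * cmod (f 0) + (\<mu> z * cmod (\<psi> z) * \<Omega> (\<phi> z)) * \<beta> f"
        by (simp add: algebra_simps)
      \<comment> \<open>The two parts of the Bloch norm are weighted separately and each weight is
        at most \<open>m\<close>; hence a maximum and not a sum.\<close>
      also have "\<dots> \<le> m * cmod (f 0) + m * \<beta> f"
      proof (intro add_mono mult_right_mono)
        show "\<mu> z * cmod (\<psi> z) \<le> m" using H_upper[OF \<psi>H z] by (simp add: m_def)
        show "\<mu> z * cmod (\<psi> z) * \<Omega> (\<phi> z) \<le> m"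
          using cSup_upper[OF imageI[OF z] bdd] by (simp add: m_def)
      qed (use seminorm_nonneg[OF XB[OF f]] in auto)
      finally show ?thesis by (simp add: bloch_norm_def algebra_simps)
    qed
    have "holo (W f) D"
      unfolding W_def wcomp_def
      by (intro holo_mult \<psi> holo_compose[OF bloch_holo[OF XB[OF f]] \<phi>])
    then have "W f \<in> ?HS" using le by (auto simp: Hinf_space_def intro!: bdd_aboveI2)
    moreover have "?H (W f) \<le> m * ?N f"
      unfolding Hinf_norm_def using zero_in_D le by (intro cSUP_least) auto
    ultimately show ?thesis by simp
  qed
  have equiv: "bounded_op W X ?N ?HS ?H \<longleftrightarrow> \<psi> \<in> ?HS \<and> bdd_above ?U"
  proof
    assume r: "\<psi> \<in> ?HS \<and> bdd_above ?U"
    show "bounded_op W X ?N ?HS ?H"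
      unfolding bounded_op_def
      using est[OF conjunct1[OF r] conjunct2[OF r]] by (intro conjI exI[of _ m] ballI) simp_all
  qed (rule fwd)
  have "op_norm W X ?N ?H = m" if bop: "bounded_op W X ?N ?HS ?H"
  proof -
    have \<psi>H: "\<psi> \<in> ?HS" and bdd: "bdd_above ?U" using fwd[OF bop] by auto
    have m0: "0 \<le> m" using H_nonneg[OF \<psi>H] by (simp add: m_def)
    have N1: "?N (\<lambda>_. 1) \<le> 1" by (simp add: bloch_norm_const)
    show ?thesis
      unfolding op_norm_def
    proof (rule cSup_eq_non_empty)
      show "{?H (W f) | f. f \<in> X \<and> ?N f \<le> 1} \<noteq> {}" using const[of 1] N1 by blast
      fix x assume "x \<in> {?H (W f) | f. f \<in> X \<and> ?N f \<le> 1}"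
      then obtain f where f: "f \<in> X" "?N f \<le> 1" "x = ?H (W f)" by blast
      show "x \<le> m" using est[OF \<psi>H bdd f(1)] mult_left_mono[OF f(2) m0] f(3) by simp
    next
      fix y assume y: "\<And>x. x \<in> {?H (W f) | f. f \<in> X \<and> ?N f \<le> 1} \<Longrightarrow> x \<le> y"
      have y': "?H (W f) \<le> y" if "f \<in> X" "?N f \<le> 1" for f using that by (intro y) blast
      \<comment> \<open>The constant 1 has Bloch norm 1 and is mapped to \<psi>.\<close>
      have \<psi>y: "?H \<psi> \<le> y" using y'[OF const N1] by (simp add: W1)
      then have "0 \<le> y" using H_nonneg[OF \<psi>H] by simp
      then have "Sup ?U \<le> y"
        using zero_in_D est[OF \<psi>H bdd] y' by (intro cSUP_least U_le) auto
      with \<psi>y show "m \<le> y" by (simp add: m_def)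
    qed
  qed
  with equiv show ?thesis by (simp add: m_def)
qed

end

theorem theorem3p2:
  fixes D :: "'n::finite cvec set" and \<mu> :: "'n cvec \<Rightarrow> real"
    and \<psi> :: "'n cvec \<Rightarrow> complex" and \<phi> :: "'n cvec \<Rightarrow> 'n cvec"
  assumes "homogeneous_domain D" and "bounded D" and "0 \<in> D"
    and "weight D \<mu>"
    and "holo \<psi> D"
    and "holo_map \<phi> D" and "\<phi> ` D \<subseteq> D"
  shows
    "(bounded_op (wcomp \<psi> \<phi>) (bloch_space D) (bloch_norm D) (Hinf_space D \<mu>) (Hinf_norm D \<mu>)
        \<longleftrightarrow> \<psi> \<in> Hinf_space D \<mu> \<and>
            bdd_above ((\<lambda>z. \<mu> z * cmod (\<psi> z) * omega_fun D (\<phi> z)) ` D))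
     \<and> (bounded_op (wcomp \<psi> \<phi>) (bloch_space D) (bloch_norm D) (Hinf_space D \<mu>) (Hinf_norm D \<mu>)
        \<longrightarrow> op_norm (wcomp \<psi> \<phi>) (bloch_space D) (bloch_norm D) (Hinf_norm D \<mu>)
            = max (Hinf_norm D \<mu> \<psi>)
                  (Sup ((\<lambda>z. \<mu> z * cmod (\<psi> z) * omega_fun D (\<phi> z)) ` D)))
     \<and> (bounded_op (wcomp \<psi> \<phi>) (little_bloch_star D) (bloch_norm D) (Hinf_space D \<mu>) (Hinf_norm D \<mu>)
        \<longleftrightarrow> \<psi> \<in> Hinf_space D \<mu> \<and>
            bdd_above ((\<lambda>z. \<mu> z * cmod (\<psi> z) * omega0_fun D (\<phi> z)) ` D))
     \<and> (bounded_op (wcomp \<psi> \<phi>) (little_bloch_star D) (bloch_norm D) (Hinf_space D \<mu>) (Hinf_norm D \<mu>)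
        \<longrightarrow> op_norm (wcomp \<psi> \<phi>) (little_bloch_star D) (bloch_norm D) (Hinf_norm D \<mu>)
            = max (Hinf_norm D \<mu> \<psi>)
                  (Sup ((\<lambda>z. \<mu> z * cmod (\<psi> z) * omega0_fun D (\<phi> z)) ` D)))"
proof -
  interpret bounded_domain D
    using assms(1-3) by unfold_locales (auto simp: homogeneous_domain_def domain_def)
  have \<mu>: "\<And>z. z \<in> D \<Longrightarrow> 0 < \<mu> z" using assms(4) by (simp add: weight_def)
  have little: "little_bloch_star D \<subseteq> bloch_space D" by (auto simp: little_bloch_star_def)
  show ?thesis
    using weighted_composition_criterion[OF order_refl bloch_const bloch_affine \<mu> assms(5-7)]
      weighted_composition_criterion[OF little little_bloch_const little_bloch_affine \<mu> assms(5-7)]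
    unfolding omega_fun_def omega0_fun_def by simp
qed

end
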